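(* Let $A$ be a computably enumerable set such that $A\not\leq_K\emptyset$, and let $X$ be a $\Delta^0_2$ set such that $X\not\leq_K\emptyset$. Then there are disjoint computably enumerable sets $A_0,A_1$ with $A=A_0\cup A_1$ such that $A_0\not\leq_K A_1$, $A_1\not\leq_K A_0$, and for each $i\in\{0,1\}$: $A_i\leq_K A$, $A\not\leq_K A_i$, and $X\not\leq_K A_i$.
   Context: Sets are identified with their binary characteristic sequences; $Y\restriction_n$ is the string of the first $n$ bits of $Y$. $K$ denotes prefix-free Kolmogorov complexity with respect to a fixed optimal prefix-free machine. For sets $Y,Z$, $Y\leq_K Z$ means there is a constant $c$ with $K(Y\restriction_n)\leq K(Z\restriction_n)+c$ for all $n$; thus $Y\leq_K\emptyset$ means $Y$ is $K$-trivial, i.e. $K(Y\restriction_n)\leq K(n)+c$ for some $c$ and all $n$. *)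

theory Defs
  imports Main "HOL-Library.Extended_Nat" "HOL-Library.Sublist"
begin

datatype recf = Zero | Succ | Proj nat | Comp recf "recf list" | Prim recf recf | Mn recf

inductive eval :: "recf \<Rightarrow> nat list \<Rightarrow> nat \<Rightarrow> bool" where
  eval_zero: "eval Zero xs 0"
| eval_succ: "eval Succ (x # xs) (Suc x)"
| eval_proj: "i < length xs \<Longrightarrow> eval (Proj i) xs (xs ! i)"
| eval_comp: "list_all2 (\<lambda>g y. eval g xs y) gs ys \<Longrightarrow> eval f ys z \<Longrightarrow> eval (Comp f gs) xs z"
| eval_prim0: "eval f xs z \<Longrightarrow> eval (Prim f g) (0 # xs) z"
| eval_primS: "eval (Prim f g) (n # xs) y \<Longrightarrow> eval g (n # y # xs) z \<Longrightarrow> eval (Prim f g) (Suc n # xs) z"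
| eval_mn: "eval f (n # xs) 0 \<Longrightarrow> (\<forall>m<n. \<exists>y. eval f (m # xs) (Suc y)) \<Longrightarrow> eval (Mn f) xs n"

definition ce :: "nat set \<Rightarrow> bool" where
  "ce A \<longleftrightarrow> (\<exists>r. \<forall>x. x \<in> A \<longleftrightarrow> (\<exists>y. eval r [x] y))"

definition computable_rel3 :: "(nat \<Rightarrow> nat \<Rightarrow> nat \<Rightarrow> bool) \<Rightarrow> bool" where
  "computable_rel3 R \<longleftrightarrow> (\<exists>r. \<forall>x y z. eval r [x, y, z] (if R x y z then 1 else 0))"

definition sigma02 :: "nat set \<Rightarrow> bool" where
  "sigma02 X \<longleftrightarrow> (\<exists>R. computable_rel3 R \<and> (\<forall>x. x \<in> X \<longleftrightarrow> (\<exists>y. \<forall>z. R x y z)))"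

definition pi02 :: "nat set \<Rightarrow> bool" where
  "pi02 X \<longleftrightarrow> (\<exists>R. computable_rel3 R \<and> (\<forall>x. x \<in> X \<longleftrightarrow> (\<forall>y. \<exists>z. R x y z)))"

definition delta02 :: "nat set \<Rightarrow> bool" where
  "delta02 X \<longleftrightarrow> sigma02 X \<and> pi02 X"

text \<open>Bijective coding of binary strings by natural numbers.\<close>
fun enc :: "bool list \<Rightarrow> nat" where
  "enc [] = 0"
| "enc (b # bs) = 2 * enc bs + (if b then 2 else 1)"

definition partial_computable_machine :: "(bool list \<Rightarrow> bool list option) \<Rightarrow> bool" where
  "partial_computable_machine M \<longleftrightarrow>
     (\<exists>r. \<forall>\<tau> \<sigma>. eval r [enc \<tau>] (enc \<sigma>) \<longleftrightarrow> M \<tau> = Some \<sigma>)"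

definition prefix_free_machine :: "(bool list \<Rightarrow> bool list option) \<Rightarrow> bool" where
  "prefix_free_machine M \<longleftrightarrow> partial_computable_machine M \<and>
     (\<forall>\<tau> \<tau>'. M \<tau> \<noteq> None \<longrightarrow> M \<tau>' \<noteq> None \<longrightarrow> prefix \<tau> \<tau>' \<longrightarrow> \<tau> = \<tau>')"

text \<open>Complexity relative to a machine (infinity if no description exists).\<close>
definition KM :: "(bool list \<Rightarrow> bool list option) \<Rightarrow> bool list \<Rightarrow> enat" where
  "KM M \<sigma> = Inf {enat (length \<tau>) | \<tau>. M \<tau> = Some \<sigma>}"

definition optimal_pf_machine :: "(bool list \<Rightarrow> bool list option) \<Rightarrow> bool" where
  "optimal_pf_machine U \<longleftrightarrow> prefix_free_machine U \<and>
     (\<forall>M. prefix_free_machine M \<longrightarrow> (\<exists>c::nat. \<forall>\<sigma>. KM U \<sigma> \<le> KM M \<sigma> + enat c))"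

definition init_seg :: "nat set \<Rightarrow> nat \<Rightarrow> bool list" where
  "init_seg Y n = map (\<lambda>i. i \<in> Y) [0..<n]"

definition K_le :: "(bool list \<Rightarrow> bool list option) \<Rightarrow> nat set \<Rightarrow> nat set \<Rightarrow> bool" where
  "K_le U Y Z \<longleftrightarrow> (\<exists>c::nat. \<forall>n. KM U (init_seg Y n) \<le> KM U (init_seg Z n) + enat c)"

end

theory Submission
  imports Defs "HOL-Library.Nat_Bijection"
begin

text \<open>Sacks splitting without injuries. As numbers enter \<open>A\<close>, each is put into \<open>A0\<close> or \<open>A1\<close>. Whenever
  the stage approximations make \<open>K (Y\<restriction>n) \<le> K (A\<^sub>i\<restriction>n) + c\<close> look true for all \<open>n \<le> m\<close>, the
  requirement refuting it protects \<open>m\<close>, for good: from then on it wants \<open>m\<close> kept out of \<open>A\<^sub>i\<close>, and the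
  strongest requirement protecting a number decides its side. If a requirement protected infinitely
  many numbers, its inequality would hold in the limit, so it would eventually protect every number;
  then \<open>A\<^sub>i\<close> would be decidable, hence \<open>K\<close>-trivial, and so would \<open>Y\<close>. This is absurd for \<open>Y = X\<close>, and
  for \<open>Y = A\<^sub>1\<^sub>-\<^sub>i\<close> it makes \<open>A = Y \<union> A\<^sub>i\<close> \<open>K\<close>-trivial. Finally \<open>A\<^sub>i \<le>\<^sub>K A\<close> because numbers are sorted
  as soon as they appear, and \<open>A \<le>\<^sub>K A\<^sub>i\<close> would give \<open>A\<^sub>1\<^sub>-\<^sub>i \<le>\<^sub>K A\<^sub>i\<close>.\<close>

section \<open>Total computable functions and decidable predicates\<close>

lemma eval_Comp1: "eval g xs a \<Longrightarrow> eval f [a] z \<Longrightarrow> eval (Comp f [g]) xs z"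
  by (rule eval_comp[where ys = "[a]"]) auto

lemma eval_Comp2: "eval g xs a \<Longrightarrow> eval h xs b \<Longrightarrow> eval f [a, b] z \<Longrightarrow> eval (Comp f [g, h]) xs z"
  by (rule eval_comp[where ys = "[a, b]"]) auto

lemma eval_Comp3:
  "eval g xs a \<Longrightarrow> eval h xs b \<Longrightarrow> eval k xs c \<Longrightarrow> eval f [a, b, c] z \<Longrightarrow> eval (Comp f [g, h, k]) xs z"
  by (rule eval_comp[where ys = "[a, b, c]"]) auto

lemma eval_Proj: "i < length xs \<Longrightarrow> xs ! i = y \<Longrightarrow> eval (Proj i) xs y"
  using eval_proj by blast

text \<open>Turns \<open>Prim\<close> into HOL recursion: once an operation is written as a
  \<open>rec_nat\<close>, only its base and step need realizers. The step sees the counter, then the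
  previous value.\<close>

lemma eval_Prim_rec_nat:
  assumes "eval f xs a" and "\<And>i y. eval g (i # y # xs) (h i y)"
  shows "eval (Prim f g) (n # xs) (rec_nat a h n)"
  by (induction n) (auto intro: assms eval_prim0 eval_primS)

text \<open>Closure properties are developed for unary functions, with further arguments packed into
  pairs. \<open>computable2\<close> serves the base operations that precede pairing, and functions
  to be minimized.\<close>

definition computable :: "(nat \<Rightarrow> nat) \<Rightarrow> bool" where
  "computable f \<longleftrightarrow> (\<exists>r. \<forall>x. eval r [x] (f x))"

definition computable2 :: "(nat \<Rightarrow> nat \<Rightarrow> nat) \<Rightarrow> bool" where
  "computable2 f \<longleftrightarrow> (\<exists>r. \<forall>x y. eval r [x, y] (f x y))"

definition decidable :: "(nat \<Rightarrow> bool) \<Rightarrow> bool" where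
  "decidable P \<longleftrightarrow> computable (\<lambda>x. of_bool (P x))"

named_theorems computable_intros

lemma computable_id [computable_intros]: "computable (\<lambda>x. x)"
  unfolding computable_def by (rule exI[of _ "Proj 0"]) (auto intro: eval_Proj)

lemma computable_comp:
  assumes "computable f" "computable g" shows "computable (\<lambda>x. f (g x))"
  using assms unfolding computable_def by (meson eval_Comp1)

lemma computable2_comp:
  assumes "computable2 f" "computable g" "computable h"
  shows "computable (\<lambda>x. f (g x) (h x))"
  using assms unfolding computable_def computable2_def by (meson eval_Comp2)

lemma computable_Suc [computable_intros]:
  assumes "computable f" shows "computable (\<lambda>x. Suc (f x))"
  by (rule computable_comp[OF _ assms]) (use eval_succ in \<open>auto simp: computable_def\<close>)

lemma computable_const [computable_intros]: "computable (\<lambda>_. c)"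
proof (induction c)
  case 0
  show ?case using eval_zero by (auto simp: computable_def)
next
  case (Suc c)
  then show ?case by (rule computable_Suc)
qed

lemma computable2_add: "computable2 (+)"
proof -
  have *: "rec_nat y (\<lambda>_. Suc) x = x + y" for x y :: nat by (induction x) auto
  have "eval (Prim (Proj 0) (Comp Succ [Proj 1])) [x, y] (rec_nat y (\<lambda>_. Suc) x)" for x y
    by (rule eval_Prim_rec_nat) (auto intro!: eval_Proj eval_Comp1 eval_succ)
  then show ?thesis unfolding computable2_def * by blast
qed

lemma computable2_diff: "computable2 (-)"
proof -
  have p: "rec_nat 0 (\<lambda>i _. i) x = x - 1" for x :: nat by (cases x) auto
  have pred: "eval (Prim Zero (Proj 0)) [x] (x - 1)" for x
    unfolding p[symmetric] by (rule eval_Prim_rec_nat) (auto intro!: eval_Proj eval_zero)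
  have *: "rec_nat x (\<lambda>_ a. a - 1) y = x - y" for x y :: nat by (induction y) auto
  have "eval (Prim (Proj 0) (Comp (Prim Zero (Proj 0)) [Proj 1])) [y, x] (rec_nat x (\<lambda>_ a. a - 1) y)" for x y
    by (rule eval_Prim_rec_nat) (auto intro!: eval_Proj eval_Comp1[OF _ pred] simp del: One_nat_def)
  \<comment> \<open>\<open>Prim\<close> recurses on its first argument, but subtraction recurses on
    the second, so the arguments are swapped.\<close>
  then have "eval (Comp (Prim (Proj 0) (Comp (Prim Zero (Proj 0)) [Proj 1])) [Proj 1, Proj 0]) [x, y] (x - y)" for x y
    unfolding * by (rule eval_Comp2[rotated 2]) (auto intro!: eval_Proj)
  then show ?thesis unfolding computable2_def by blast
qed

lemmas computable_add [computable_intros] = computable2_comp[OF computable2_add]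
lemmas computable_diff [computable_intros] = computable2_comp[OF computable2_diff]

text \<open>As \<open>f\<close> is total, every candidate below the least zero has a positive value,
  which is the side condition of \<open>eval_mn\<close>. The searched argument comes first, as
  \<open>Mn\<close> requires.\<close>

lemma computable_LEAST_eq_0:
  assumes "computable2 f" "\<And>x. \<exists>y. f y x = 0"
  shows "computable (\<lambda>x. LEAST y. f y x = 0)"
proof -
  from assms(1) obtain r where r: "\<And>x y. eval r [x, y] (f x y)" by (auto simp: computable2_def)
  have "eval (Mn r) [x] (LEAST y. f y x = 0)" for x
  proof (rule eval_mn)
    show "eval r [LEAST y. f y x = 0, x] 0"
      using r[of "LEAST y. f y x = 0" x] LeastI_ex[OF assms(2)[of x]] by simp
    show "\<forall>m<LEAST y. f y x = 0. \<exists>y. eval r [m, x] (Suc y)"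
      using r[of _ x] not_less_Least[of _ "\<lambda>y. f y x = 0"] by (metis not0_implies_Suc)
  qed
  then show ?thesis unfolding computable_def by blast
qed

section \<open>Cantor pairing and its inverses\<close>

lemma computable_triangle: "computable triangle"
proof -
  obtain r where r: "\<And>x y. eval r [x, y] (x + y)" using computable2_add by (auto simp: computable2_def)
  have *: "rec_nat 0 (\<lambda>i y. Suc i + y) x = triangle x" for x by (induction x) auto
  have "eval (Prim Zero (Comp r [Comp Succ [Proj 0], Proj 1])) [x] (rec_nat 0 (\<lambda>i y. Suc i + y) x)" for x
    by (rule eval_Prim_rec_nat) (auto intro!: eval_zero eval_Comp2[OF _ _ r] eval_Comp1 eval_succ eval_Proj simp del: add_Suc)
  then show ?thesis unfolding computable_def * by blast
qed

lemma computable2_pair: "computable2 (\<lambda>x y. prod_encode (x, y))"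
proof -
  obtain r where r: "\<And>x y. eval r [x, y] (x + y)" using computable2_add by (auto simp: computable2_def)
  obtain t where t: "\<And>x. eval t [x] (triangle x)" using computable_triangle by (auto simp: computable_def)
  have "eval (Comp r [Comp t [r], Proj 0]) [x, y] (prod_encode (x, y))" for x y
    by (auto intro!: eval_Comp2[OF _ _ r] eval_Comp1[OF _ t] r eval_Proj simp: prod_encode_def)
  then show ?thesis unfolding computable2_def by blast
qed

lemmas computable_pair [computable_intros] = computable2_comp[OF computable2_pair]

definition pfst :: "nat \<Rightarrow> nat" where "pfst z = fst (prod_decode z)"
definition psnd :: "nat \<Rightarrow> nat" where "psnd z = snd (prod_decode z)"

lemma pfst_pair [simp]: "pfst (prod_encode (x, y)) = x"
  and psnd_pair [simp]: "psnd (prod_encode (x, y)) = y"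
  and pair_pfst_psnd [simp]: "prod_encode (pfst z, psnd z) = z"
  by (auto simp: pfst_def psnd_def)

lemma triangle_mono: "m \<le> n \<Longrightarrow> triangle m \<le> triangle n"
  by (induction n) (auto simp: le_Suc_eq)

text \<open>\<open>prod_encode (a, b) = triangle (a + b) + a\<close>, so the diagonal \<open>a + b\<close> is the largest
  \<open>d\<close> whose triangle number does not exceed the code.\<close>
lemma prod_encode_diagonal:
  "(LEAST d. Suc (prod_encode (a, b)) - triangle (Suc d) = 0) = a + b"
proof (rule Least_equality)
  show "Suc (prod_encode (a, b)) - triangle (Suc (a + b)) = 0" by (simp add: prod_encode_def)
  fix d assume "Suc (prod_encode (a, b)) - triangle (Suc d) = 0"
  then have "triangle (a + b) < triangle (Suc d)" by (simp add: prod_encode_def)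
  then show "a + b \<le> d" using triangle_mono[of "Suc d" "a + b"] by linarith
qed

text \<open>The diagonal of \<open>z\<close> is found by a search that succeeds at \<open>z\<close>
  itself; the first component is the excess of \<open>z\<close> over the triangle number, the second
  the rest of the diagonal.\<close>

lemma computable_unpair: "computable pfst" "computable psnd"
proof -
  define d where "d z = (LEAST d. Suc z - triangle (Suc d) = 0)" for z
  have d: "d z = pfst z + psnd z" for z
    unfolding d_def using prod_encode_diagonal[of "pfst z" "psnd z"] by simp
  obtain s where s: "\<And>x y. eval s [x, y] (x - y)" using computable2_diff by (auto simp: computable2_def)
  obtain t where t: "\<And>x. eval t [x] (triangle x)" using computable_triangle by (auto simp: computable_def)
  have "eval (Comp s [Comp Succ [Proj 1], Comp t [Comp Succ [Proj 0]]]) [e, z] (Suc z - triangle (Suc e))" for e z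
    by (rule eval_Comp2[OF _ _ s]) (auto intro!: eval_Comp1 eval_Comp1[OF _ t] eval_succ eval_Proj simp del: triangle_Suc)
  then have "computable2 (\<lambda>e z. Suc z - triangle (Suc e))" unfolding computable2_def by blast
  then have cd: "computable d" unfolding d_def
  proof (rule computable_LEAST_eq_0)
    fix z
    have "z \<le> triangle z" by (induction z) auto
    then show "\<exists>y. Suc z - triangle (Suc y) = 0" by (intro exI[of _ z]) simp
  qed
  have 1: "pfst z = z - triangle (d z)" for z
    using pair_pfst_psnd[of z] unfolding d prod_encode_def by simp
  show *: "computable pfst" unfolding 1
    by (intro computable_intros computable_comp[OF computable_triangle] cd)
  have 2: "psnd z = d z - pfst z" for z by (simp add: d)
  show "computable psnd" unfolding 2 by (intro computable_intros * cd)
qed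

lemmas computable_pfst [computable_intros] = computable_comp[OF computable_unpair(1)]
lemmas computable_psnd [computable_intros] = computable_comp[OF computable_unpair(2)]

text \<open>The parameter \<open>x\<close> is carried through the recursion. \<open>Prim\<close>
  supplies counter, value and \<open>x\<close> in this order, which are repacked as the nested pair
  that \<open>G\<close> reads.\<close>

lemma computable_rec_nat:
  assumes "computable f" "computable (\<lambda>z. G (pfst z) (pfst (psnd z)) (psnd (psnd z)))" "computable b"
  shows "computable (\<lambda>x. rec_nat (f x) (G x) (b x))"
proof -
  obtain p where p: "\<And>x y. eval p [x, y] (prod_encode (x, y))"
    using computable2_pair by (auto simp: computable2_def)
  obtain rf rg rb where rf: "\<And>x. eval rf [x] (f x)" and rb: "\<And>x. eval rb [x] (b x)"
    and rg: "\<And>z. eval rg [z] (G (pfst z) (pfst (psnd z)) (psnd (psnd z)))"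
    using assms by (auto simp: computable_def)
  have rg: "eval rg [prod_encode (x, prod_encode (i, y))] (G x i y)" for x i y
    using rg[of "prod_encode (x, prod_encode (i, y))"] by simp
  have "eval (Prim rf (Comp rg [Comp p [Proj 2, Comp p [Proj 0, Proj 1]]])) [n, x] (rec_nat (f x) (G x) n)" for n x
    by (rule eval_Prim_rec_nat[OF rf])
       (auto intro!: eval_Comp1[OF _ rg] eval_Comp2[OF _ _ p] eval_Proj)
  then have "eval (Comp (Prim rf (Comp rg [Comp p [Proj 2, Comp p [Proj 0, Proj 1]]])) [rb, Proj 0]) [x]
      (rec_nat (f x) (G x) (b x))" for x
    by (rule eval_Comp2[rotated 2]) (auto intro!: eval_Proj rb)
  then show ?thesis unfolding computable_def by blast
qed

lemma computable_mult [computable_intros]: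
  assumes "computable f" "computable g" shows "computable (\<lambda>x. f x * g x)"
proof -
  have m: "m * n = rec_nat 0 (\<lambda>_ y. y + n) m" for m n :: nat by (induction m) auto
  have *: "f x * g x = rec_nat 0 (\<lambda>_ y. y + g x) (f x)" for x using m by simp
  show ?thesis unfolding *
    by (rule computable_rec_nat) (intro computable_intros computable_comp[OF assms(2)] assms)+
qed

lemma computable_power [computable_intros]:
  assumes "computable f" "computable g" shows "computable (\<lambda>x. f x ^ g x)"
proof -
  have m: "m ^ n = rec_nat 1 (\<lambda>_ y. y * m) n" for m n :: nat by (induction n) auto
  have *: "f x ^ g x = rec_nat 1 (\<lambda>_ y. y * f x) (g x)" for x using m by simp
  show ?thesis unfolding *
    by (rule computable_rec_nat) (intro computable_intros computable_comp[OF assms(1)] assms)+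
qed

section \<open>Closure properties of decidable predicates, bounded quantifiers and
  minimization\<close>

lemma computable_of_bool: "decidable P \<Longrightarrow> computable (\<lambda>x. of_bool (P x))"
  by (simp add: decidable_def)

lemma decidable_comp: "decidable P \<Longrightarrow> computable f \<Longrightarrow> decidable (\<lambda>x. P (f x))"
  unfolding decidable_def by (rule computable_comp)

text \<open>Hypotheses on binary predicates are stated through \<open>pfst\<close> and
  \<open>psnd\<close>; this rule instantiates them at arbitrary computable arguments.\<close>

lemma decidable_uncurry:
  assumes "decidable (\<lambda>z. P (pfst z) (psnd z))" "computable f" "computable g"
  shows "decidable (\<lambda>x. P (f x) (g x))"
  using decidable_comp[OF assms(1) computable_pair[OF assms(2,3)]] by simp

lemma computable_uncurry:
  assumes "computable (\<lambda>z. F (pfst z) (psnd z))" "computable f" "computable g"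
  shows "computable (\<lambda>x. F (f x) (g x))"
  using computable_comp[OF assms(1) computable_pair[OF assms(2,3)]] by simp

lemma decidable_const [computable_intros]: "decidable (\<lambda>_. b)"
  unfolding decidable_def by (rule computable_const)

lemma decidable_less [computable_intros]:
  assumes "computable f" "computable g" shows "decidable (\<lambda>x. f x < g x)"
proof -
  have *: "of_bool (f x < g x) = 1 - (Suc (f x) - g x)" for x by auto
  show ?thesis unfolding decidable_def * by (intro computable_intros assms)
qed

lemma decidable_not [computable_intros]:
  assumes "decidable P" shows "decidable (\<lambda>x. \<not> P x)"
proof -
  have *: "of_bool (\<not> P x) = 1 - (of_bool (P x) :: nat)" for x by simp
  show ?thesis unfolding decidable_def * by (intro computable_intros computable_of_bool assms)
qed

lemma decidable_conj [computable_intros]: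
  assumes "decidable P" "decidable Q" shows "decidable (\<lambda>x. P x \<and> Q x)"
  unfolding decidable_def of_bool_conj by (intro computable_intros computable_of_bool assms)

lemma decidable_disj [computable_intros]:
  assumes "decidable P" "decidable Q" shows "decidable (\<lambda>x. P x \<or> Q x)"
  using decidable_not[OF decidable_conj[OF assms[THEN decidable_not]]] by simp

lemma decidable_le [computable_intros]:
  assumes "computable f" "computable g" shows "decidable (\<lambda>x. f x \<le> g x)"
  using decidable_not[OF decidable_less[OF assms(2,1)]] by (simp add: not_less)

lemma decidable_eq [computable_intros]:
  assumes "computable f" "computable g" shows "decidable (\<lambda>x. f x = g x)"
  using decidable_conj[OF decidable_le[OF assms] decidable_le[OF assms(2,1)]] by (simp add: eq_iff)

lemma computable_if [computable_intros]:
  assumes "decidable P" "computable f" "computable g"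
  shows "computable (\<lambda>x. if P x then f x else g x)"
proof -
  have *: "(if P x then f x else g x) = of_bool (P x) * f x + (1 - of_bool (P x)) * g x" for x by simp
  show ?thesis unfolding * by (intro computable_intros computable_of_bool assms)
qed

lemma decidable_if [computable_intros]:
  assumes "decidable P" "decidable Q" "decidable R"
  shows "decidable (\<lambda>x. if P x then Q x else R x)"
proof -
  have *: "(if P x then Q x else R x) = ((P x \<and> Q x) \<or> (\<not> P x \<and> R x))" for x by simp
  show ?thesis unfolding * by (intro computable_intros assms)
qed

lemma decidable_ex_less [computable_intros]:
  assumes "computable b" "decidable (\<lambda>z. P (pfst z) (psnd z))"
  shows "decidable (\<lambda>x. \<exists>y<b x. P x y)"
proof -
  have *: "of_bool (\<exists>y<n. P x y) = rec_nat (0::nat) (\<lambda>i a. of_bool (0 < a \<or> P x i)) n" for x n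
  proof (induction n)
    case (Suc n)
    have "(\<exists>y<Suc n. P x y) \<longleftrightarrow> 0 < (of_bool (\<exists>y<n. P x y) :: nat) \<or> P x n" by (auto simp: less_Suc_eq)
    then show ?case using Suc by simp
  qed simp
  have P: "decidable (\<lambda>z. P (pfst z) (pfst (psnd z)))"
    by (rule decidable_uncurry[OF assms(2)]) (intro computable_intros)+
  show ?thesis unfolding decidable_def *
    by (rule computable_rec_nat) (intro computable_intros computable_of_bool assms P)+
qed

lemma decidable_all_less [computable_intros]:
  assumes "computable b" "decidable (\<lambda>z. P (pfst z) (psnd z))"
  shows "decidable (\<lambda>x. \<forall>y<b x. P x y)"
  using decidable_not[OF decidable_ex_less[OF assms(1) decidable_not[OF assms(2)]]] by simp

lemma computable_LEAST:
  assumes "decidable (\<lambda>z. P (pfst z) (psnd z))" "\<And>x. \<exists>y. P x y"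
  shows "computable (\<lambda>x. LEAST y. P x y)"
proof -
  from assms(1) obtain r where r: "\<And>z. eval r [z] (of_bool (P (pfst z) (psnd z)))"
    by (auto simp: decidable_def computable_def)
  obtain p where p: "\<And>x y. eval p [x, y] (prod_encode (x, y))"
    using computable2_pair by (auto simp: computable2_def)
  obtain s where s: "\<And>x y. eval s [x, y] (x - y)" using computable2_diff by (auto simp: computable2_def)
  have r': "eval r [prod_encode (x, y)] (of_bool (P x y))" for x y using r[of "prod_encode (x, y)"] by simp
  have "eval (Comp s [Comp Succ [Zero], Comp r [Comp p [Proj 1, Proj 0]]]) [y, x] (Suc 0 - of_bool (P x y))" for x y
    by (intro eval_Comp2[OF _ _ s] eval_Comp1[OF _ r'] eval_Comp1[OF eval_zero eval_succ] eval_Comp2[OF _ _ p] eval_Proj) auto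
  then have *: "computable2 (\<lambda>y x. Suc 0 - of_bool (P x y))" unfolding computable2_def by blast
  have eq: "Suc 0 - of_bool (P x y) = 0 \<longleftrightarrow> P x y" for x y by simp
  show ?thesis by (rule computable_LEAST_eq_0[OF *, unfolded eq, OF assms(2)])
qed

lemma computable_div [computable_intros]:
  assumes "computable f" "computable g" shows "computable (\<lambda>x. f x div g x)"
proof -
  \<comment> \<open>The disjunct \<open>n = 0\<close> makes the search total and return 0, which is
    the HOL value of division by zero.\<close>
  have *: "m div n = (LEAST q. n = 0 \<or> m < Suc q * n)" for m n :: nat
  proof (cases "n = 0")
    case False
    show ?thesis
    proof (rule Least_equality[symmetric])
      show "n = 0 \<or> m < Suc (m div n) * n" using False dividend_less_div_times[of n m] by simp
      fix q assume "n = 0 \<or> m < Suc q * n"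
      then show "m div n \<le> q" using False less_mult_imp_div_less less_Suc_eq_le by blast
    qed
  qed simp
  show ?thesis unfolding *
  proof (rule computable_LEAST)
    show "decidable (\<lambda>z. g (pfst z) = 0 \<or> f (pfst z) < Suc (psnd z) * g (pfst z))"
      by (intro computable_intros computable_comp[OF assms(1)] computable_comp[OF assms(2)])
    show "\<exists>q. g x = 0 \<or> f x < Suc q * g x" for x
      by (rule exI[of _ "f x"]) (cases "g x", auto)
  qed
qed

lemma computable_mod [computable_intros]:
  assumes "computable f" "computable g" shows "computable (\<lambda>x. f x mod g x)"
  unfolding minus_div_mult_eq_mod[symmetric] by (intro computable_intros assms)

lemma decidable_mem_set_decode [computable_intros]:
  assumes "computable f" "computable g" shows "decidable (\<lambda>x. f x \<in> set_decode (g x))"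
proof -
  have *: "f x \<in> set_decode (g x) \<longleftrightarrow> (g x div 2 ^ f x) mod 2 = 1" for x
    by (simp add: set_decode_def odd_iff_mod_2_eq_one)
  show ?thesis unfolding * by (intro computable_intros assms)
qed

lemma computable_set_encode [computable_intros]:
  assumes "computable b" "decidable (\<lambda>z. P (pfst z) (psnd z))"
  shows "computable (\<lambda>x. set_encode {y. y < b x \<and> P x y})"
proof -
  have "set_encode {y. y < n \<and> P x y} = rec_nat 0 (\<lambda>i a. a + (if P x i then 2 ^ i else 0)) n" for x n
  proof (induction n)
    case (Suc n)
    have "{y. y < Suc n \<and> P x y} = (if P x n then insert n else id) {y. y < n \<and> P x y}"
      by (auto simp: less_Suc_eq)
    then show ?case using Suc by simp
  qed simp
  note * = this
  have P: "decidable (\<lambda>z. P (pfst z) (pfst (psnd z)))"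
    by (rule decidable_uncurry[OF assms(2)]) (intro computable_intros)+
  show ?thesis unfolding *
    by (rule computable_rec_nat) (intro computable_intros assms P)+
qed

section \<open>Stage-bounded evaluation\<close>

inductive_cases eval_ZeroE: "eval Zero xs y"
inductive_cases eval_SuccE: "eval Succ xs y"
inductive_cases eval_ProjE: "eval (Proj i) xs y"
inductive_cases eval_CompE: "eval (Comp f gs) xs y"
inductive_cases eval_Prim0E: "eval (Prim f g) (0 # xs) y"
inductive_cases eval_PrimSucE: "eval (Prim f g) (Suc n # xs) y"
inductive_cases eval_PrimNilE: "eval (Prim f g) [] y"
inductive_cases eval_MnE: "eval (Mn f) xs y"

text \<open>\<open>H s l = Suc y\<close> says that the relation \<open>E\<close> has been seen by stage \<open>s\<close> to assign the
  value \<open>y\<close> to the argument list coded by \<open>l\<close>, and \<open>H s l = 0\<close> that it has no value yet.\<close>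
definition approximates :: "(nat \<Rightarrow> nat \<Rightarrow> nat) \<Rightarrow> (nat list \<Rightarrow> nat \<Rightarrow> bool) \<Rightarrow> bool" where
  "approximates H E \<longleftrightarrow> computable (\<lambda>z. H (pfst z) (psnd z)) \<and>
     (\<forall>s t l y. s \<le> t \<longrightarrow> H s l = Suc y \<longrightarrow> H t l = Suc y) \<and>
     (\<forall>xs y. E xs y \<longleftrightarrow> (\<exists>s. H s (list_encode xs) = Suc y))"

lemma
  assumes "approximates H E"
  shows approximates_computable: "computable f \<Longrightarrow> computable g \<Longrightarrow> computable (\<lambda>x. H (f x) (g x))"
    and approximates_mono: "H s l = Suc y \<Longrightarrow> s \<le> t \<Longrightarrow> H t l = Suc y"
    and approximates_iff: "E xs y \<longleftrightarrow> (\<exists>s. H s (list_encode xs) = Suc y)"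
  using assms computable_uncurry[of H f g] unfolding approximates_def by blast+

text \<open>Monotonicity in the stage lets two computations that converge at different stages be
  seen together at the later one.\<close>

lemma approximates_max:
  assumes "approximates H E" "approximates H' E'" "E xs y" "E' xs' y'"
  obtains s where "H s (list_encode xs) = Suc y" "H' s (list_encode xs') = Suc y'"
proof -
  obtain s where "H s (list_encode xs) = Suc y"
    using iffD1[OF approximates_iff[OF assms(1)] assms(3)] ..
  moreover obtain t where "H' t (list_encode xs') = Suc y'"
    using iffD1[OF approximates_iff[OF assms(2)] assms(4)] ..
  ultimately have "H (max s t) (list_encode xs) = Suc y" "H' (max s t) (list_encode xs') = Suc y'"
    by (auto intro: approximates_mono[OF assms(1)] approximates_mono[OF assms(2)])
  then show thesis by (rule that)
qed

lemma approximates_Zero: "approximates (\<lambda>_ _. 1) (eval Zero)"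
  unfolding approximates_def by (auto intro: computable_intros eval_zero elim: eval_ZeroE)

text \<open>A nonempty list is coded by \<open>Suc\<close> of the pair of head and tail, so
  \<open>pfst (l - 1)\<close> is the head. One \<open>Suc\<close> is the function computed, the
  other marks that a value exists.\<close>

lemma approximates_Succ: "approximates (\<lambda>_ l. if l = 0 then 0 else Suc (Suc (pfst (l - 1)))) (eval Succ)"
proof -
  have "eval Succ xs y \<longleftrightarrow> (if list_encode xs = 0 then 0 else Suc (Suc (pfst (list_encode xs - 1)))) = Suc y" for xs y
    by (cases xs) (auto intro: eval_succ elim: eval_SuccE)
  then show ?thesis
    unfolding approximates_def by (intro conjI computable_intros) auto
qed

lemma approximates_Proj: "\<exists>H. approximates H (eval (Proj i))"
proof -
  \<comment> \<open>\<open>T\<close> is the tail operation on list codes; it fixes 0, the code of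
    the empty list, because \<open>psnd 0 = 0\<close>.\<close>
  define T where "T l = (psnd (l - 1) :: nat)" for l
  have T: "(T ^^ i) (list_encode xs) = list_encode (drop i xs)" for i xs
  proof (induction i arbitrary: xs)
    case (Suc i)
    then have "(T ^^ Suc i) (list_encode xs) = T (list_encode (drop i xs))" by simp
    also have "\<dots> = list_encode (drop (Suc i) xs)"
    proof (cases "drop i xs")
      case Nil
      then show ?thesis by (simp add: T_def psnd_def prod_decode_def prod_decode_aux.simps)
    next
      case (Cons a list)
      then have "drop (Suc i) xs = list" by (metis drop_Suc list.sel(3) tl_drop)
      then show ?thesis using Cons by (simp add: T_def)
    qed
    finally show ?case .
  qed simp
  have c: "computable (\<lambda>l. (T ^^ i) l)"
  proof (induction i)
    case 0
    show ?case by (simp add: computable_id)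
  next
    case (Suc i)
    then have "computable (\<lambda>l. T ((T ^^ i) l))" unfolding T_def by (intro computable_intros)
    then show ?case by simp
  qed
  have "eval (Proj i) xs y \<longleftrightarrow>
      (if list_encode (drop i xs) = 0 then 0 else Suc (pfst (list_encode (drop i xs) - 1))) = Suc y" for xs y
  proof (cases "i < length xs")
    case True
    then have "drop i xs = xs ! i # drop (Suc i) xs" by (rule Cons_nth_drop_Suc[symmetric])
    then show ?thesis using True by (auto intro: eval_proj elim: eval_ProjE)
  next
    case False
    then show ?thesis by (auto elim: eval_ProjE)
  qed
  then have "approximates (\<lambda>_ l. if (T ^^ i) l = 0 then 0 else Suc (pfst ((T ^^ i) l - 1))) (eval (Proj i))"
    unfolding approximates_def T
    by (intro conjI computable_intros computable_comp[OF c]) auto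
  then show ?thesis by blast
qed

text \<open>The results of all \<open>gs\<close> are coded as one value, so that the simultaneous
  evaluation is again a relation to which \<open>approximates\<close> applies, and induction on
  \<open>gs\<close> goes through.\<close>

lemma approximates_list_all2:
  assumes "\<And>g. g \<in> set gs \<Longrightarrow> \<exists>H. approximates H (eval g)"
  shows "\<exists>G. approximates G (\<lambda>xs v. \<exists>ys. v = list_encode ys \<and> list_all2 (\<lambda>g y. eval g xs y) gs ys)"
  using assms
proof (induction gs)
  case Nil
  have "approximates (\<lambda>_ _. 1) (\<lambda>xs v. \<exists>ys. v = list_encode ys \<and> list_all2 (\<lambda>g y. eval g xs y) [] ys)"
    unfolding approximates_def by (auto intro: computable_intros)
  then show ?case by blast
next
  case (Cons g gs)
  let ?E = "\<lambda>gs xs v. \<exists>ys. v = list_encode ys \<and> list_all2 (\<lambda>g y. eval g xs y) gs ys"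
  obtain G where G: "approximates G (?E gs)" using Cons by auto
  obtain H where H: "approximates H (eval g)" using Cons.prems by auto
  define F where "F s l = (if H s l = 0 then 0 else if G s l = 0 then 0
    else Suc (Suc (prod_encode (H s l - 1, G s l - 1))))" for s l
  have F_Suc: "F s l = Suc y \<longleftrightarrow> (\<exists>u v. H s l = Suc u \<and> G s l = Suc v \<and> y = Suc (prod_encode (u, v)))" for s l y
    by (cases "H s l"; cases "G s l") (auto simp: F_def)
  have "approximates F (?E (g # gs))"
    unfolding approximates_def
  proof (intro conjI allI impI)
    show "computable (\<lambda>z. F (pfst z) (psnd z))"
      unfolding F_def by (intro computable_intros approximates_computable[OF H] approximates_computable[OF G])
    show "F t l = Suc y" if "s \<le> t" "F s l = Suc y" for s t l y
      using that approximates_mono[OF H] approximates_mono[OF G] unfolding F_Suc by blast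
    fix xs v
    show "?E (g # gs) xs v \<longleftrightarrow> (\<exists>s. F s (list_encode xs) = Suc v)"
    proof
      assume "?E (g # gs) xs v"
      then obtain y ys where *: "v = list_encode (y # ys)" "eval g xs y" "list_all2 (\<lambda>g y. eval g xs y) gs ys"
        by (auto simp: list_all2_Cons1)
      then have "?E gs xs (list_encode ys)" by blast
      from approximates_max[OF H G *(2) this] obtain s
        where "H s (list_encode xs) = Suc y" "G s (list_encode xs) = Suc (list_encode ys)" .
      then show "\<exists>s. F s (list_encode xs) = Suc v" unfolding F_Suc using *(1) by auto
    next
      assume "\<exists>s. F s (list_encode xs) = Suc v"
      then obtain u w where "eval g xs u" "?E gs xs w" "v = Suc (prod_encode (u, w))"
        unfolding F_Suc approximates_iff[OF H] approximates_iff[OF G] by blast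
      then obtain ys where "v = list_encode (u # ys)" "list_all2 (\<lambda>g y. eval g xs y) (g # gs) (u # ys)"
        by auto
      then show "?E (g # gs) xs v" by blast
    qed
  qed
  then show ?case by blast
qed

lemma approximates_Comp:
  assumes "approximates H (eval f)" "\<And>g. g \<in> set gs \<Longrightarrow> \<exists>H. approximates H (eval g)"
  shows "\<exists>H. approximates H (eval (Comp f gs))"
proof -
  let ?E = "\<lambda>xs v. \<exists>ys. v = list_encode ys \<and> list_all2 (\<lambda>g y. eval g xs y) gs ys"
  obtain G where G: "approximates G ?E" using approximates_list_all2[OF assms(2)] by blast
  define F where "F s l = (if G s l = 0 then 0 else H s (G s l - 1))" for s l
  have F_Suc: "F s l = Suc y \<longleftrightarrow> (\<exists>v. G s l = Suc v \<and> H s v = Suc y)" for s l y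
    by (cases "G s l") (auto simp: F_def)
  have "approximates F (eval (Comp f gs))"
    unfolding approximates_def
  proof (intro conjI allI impI)
    show "computable (\<lambda>z. F (pfst z) (psnd z))"
      unfolding F_def by (intro computable_intros approximates_computable[OF assms(1)] approximates_computable[OF G])
    show "F t l = Suc y" if "s \<le> t" "F s l = Suc y" for s t l y
      using that approximates_mono[OF assms(1)] approximates_mono[OF G] unfolding F_Suc by blast
    fix xs y
    show "eval (Comp f gs) xs y \<longleftrightarrow> (\<exists>s. F s (list_encode xs) = Suc y)"
    proof
      assume "eval (Comp f gs) xs y"
      then obtain ys where *: "list_all2 (\<lambda>g y. eval g xs y) gs ys" "eval f ys y" by (rule eval_CompE)
      then have "?E xs (list_encode ys)" by blast
      from approximates_max[OF G assms(1) this *(2)] obtain s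
        where "G s (list_encode xs) = Suc (list_encode ys)" "H s (list_encode ys) = Suc y" .
      then show "\<exists>s. F s (list_encode xs) = Suc y" unfolding F_Suc by blast
    next
      assume "\<exists>s. F s (list_encode xs) = Suc y"
      then obtain s v where v: "G s (list_encode xs) = Suc v" "H s v = Suc y" unfolding F_Suc by blast
      then have "?E xs v" using approximates_iff[OF G] by blast
      then obtain ys where ys: "v = list_encode ys" "list_all2 (\<lambda>g y. eval g xs y) gs ys" by blast
      with v have "eval f ys y" using approximates_iff[OF assms(1)] by blast
      with ys show "eval (Comp f gs) xs y" by (blast intro: eval_comp)
    qed
  qed
  then show ?thesis by blast
qed

lemma approximates_Prim:
  assumes H: "approximates H (eval f)" and G: "approximates G (eval g)"
  shows "\<exists>H. approximates H (eval (Prim f g))"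
proof -
  \<comment> \<open>The recursion is run with every call limited to the same stage \<open>s\<close>.
    The value 0, meaning no result yet, is propagated; otherwise \<open>a - 1\<close> is the actual
    previous value.\<close>
  define R where "R s l = rec_nat (H s l)
    (\<lambda>i a. if a = 0 then 0 else G s (Suc (prod_encode (i, Suc (prod_encode (a - 1, l))))))" for s l
  have R_0: "R s l 0 = H s l" for s l by (simp add: R_def)
  have R_Suc: "R s (list_encode xs) (Suc n) = Suc y \<longleftrightarrow>
      (\<exists>v. R s (list_encode xs) n = Suc v \<and> G s (list_encode (n # v # xs)) = Suc y)" for s xs n y
    by (cases "R s (list_encode xs) n") (auto simp: R_def)
  have R_mono: "R t (list_encode xs) n = Suc y" if "s \<le> t" "R s (list_encode xs) n = Suc y" for s t xs n y
    using that
  proof (induction n arbitrary: y)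
    case 0
    then show ?case unfolding R_0 using approximates_mono[OF H] by blast
  next
    case (Suc n)
    then obtain v where "R s (list_encode xs) n = Suc v" "G s (list_encode (n # v # xs)) = Suc y"
      unfolding R_Suc by blast
    then have "R t (list_encode xs) n = Suc v" "G t (list_encode (n # v # xs)) = Suc y"
      using Suc.IH Suc.prems(1) approximates_mono[OF G _ Suc.prems(1)] by simp_all
    then show ?case unfolding R_Suc by blast
  qed
  have R_iff: "eval (Prim f g) (n # xs) y \<longleftrightarrow> (\<exists>s. R s (list_encode xs) n = Suc y)" for n xs y
  proof (induction n arbitrary: y)
    case 0
    show ?case unfolding R_0 approximates_iff[OF H, symmetric]
      by (auto intro: eval_prim0 elim: eval_Prim0E)
  next
    case (Suc n)
    show ?case
    proof
      assume "eval (Prim f g) (Suc n # xs) y"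
      then obtain v where "eval (Prim f g) (n # xs) v" "eval g (n # v # xs) y" by (rule eval_PrimSucE)
      then obtain s t where "R s (list_encode xs) n = Suc v" "G t (list_encode (n # v # xs)) = Suc y"
        using Suc approximates_iff[OF G] by metis
      then have "R (max s t) (list_encode xs) n = Suc v" "G (max s t) (list_encode (n # v # xs)) = Suc y"
        by (auto intro: R_mono[rotated] approximates_mono[OF G])
      then show "\<exists>s. R s (list_encode xs) (Suc n) = Suc y" unfolding R_Suc by blast
    next
      assume "\<exists>s. R s (list_encode xs) (Suc n) = Suc y"
      then show "eval (Prim f g) (Suc n # xs) y"
        unfolding R_Suc using Suc approximates_iff[OF G] by (blast intro: eval_primS)
    qed
  qed
  define F where "F s l = (if l = 0 then 0 else R s (psnd (l - 1)) (pfst (l - 1)))" for s l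
  have F_Nil: "F s (list_encode []) = 0" and F_Cons: "F s (list_encode (n # xs)) = R s (list_encode xs) n" for s n xs
    by (simp_all add: F_def)
  have "approximates F (eval (Prim f g))"
    unfolding approximates_def
  proof (intro conjI allI impI)
    show "computable (\<lambda>z. F (pfst z) (psnd z))"
      unfolding F_def R_def
      by (intro computable_intros computable_rec_nat approximates_computable[OF H] approximates_computable[OF G])
    show "F t l = Suc y" if "s \<le> t" "F s l = Suc y" for s t l y
    proof (cases "list_decode l")
      case Nil
      then have "l = list_encode []" by (metis list_decode_inverse)
      then show ?thesis using that F_Nil by metis
    next
      case (Cons n xs)
      then have l: "l = list_encode (n # xs)" by (metis list_decode_inverse)
      show ?thesis using that(2) R_mono[OF that(1)] unfolding l F_Cons by blast
    qed
    fix xs y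
    show "eval (Prim f g) xs y \<longleftrightarrow> (\<exists>s. F s (list_encode xs) = Suc y)"
    proof (cases xs)
      case Nil
      then show ?thesis by (auto simp: F_def elim: eval_PrimNilE)
    next
      case (Cons n xs')
      show ?thesis unfolding Cons F_Cons by (rule R_iff)
    qed
  qed
  then show ?thesis by blast
qed

lemma approximates_Mn:
  assumes H: "approximates H (eval f)"
  shows "\<exists>H. approximates H (eval (Mn f))"
proof -
  define h where "h s n l = H s (Suc (prod_encode (n, l)))" for s n l
  have h: "h s n (list_encode xs) = H s (list_encode (n # xs))" for s n xs by (simp add: h_def)
  \<comment> \<open>For \<open>h\<close>, 0 means undefined so far, 1 means value zero and at least
    2 means a positive value. The search passes positive values only, and its outcome counts in
    \<open>F\<close> only if it stopped before \<open>s\<close> at a 1.\<close>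
  define N where "N s l = (LEAST n. n = s \<or> h s n l < 2)" for s l
  define F where "F s l = (if N s l < s \<and> h s (N s l) l = 1 then Suc (N s l) else 0)" for s l
  have F_Suc: "F s l = Suc n \<longleftrightarrow> n < s \<and> h s n l = 1 \<and> (\<forall>m<n. 2 \<le> h s m l)" for s l n
  proof
    assume "F s l = Suc n"
    then have "N s l = n" "n < s" "h s n l = 1" by (auto simp: F_def split: if_splits)
    moreover have "2 \<le> h s m l" if "m < N s l" for m
      using not_less_Least[of m "\<lambda>n. n = s \<or> h s n l < 2"] that unfolding N_def by auto
    ultimately show "n < s \<and> h s n l = 1 \<and> (\<forall>m<n. 2 \<le> h s m l)" by auto
  next
    assume *: "n < s \<and> h s n l = 1 \<and> (\<forall>m<n. 2 \<le> h s m l)"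
    have "N s l = n" unfolding N_def
    proof (rule Least_equality)
      show "n = s \<or> h s n l < 2" using * by simp
      show "n \<le> m" if "m = s \<or> h s m l < 2" for m using that * by (metis less_imp_le_nat not_le)
    qed
    then show "F s l = Suc n" using * by (simp add: F_def)
  qed
  have h_mono: "h t m l = h s m l" if "s \<le> t" "1 \<le> h s m l" for s t m l
    using that approximates_mono[OF H, of s _ "h s m l - 1" t] by (simp add: h_def)
  have F_mono: "F t l = Suc y" if "s \<le> t" "F s l = Suc y" for s t l y
  proof -
    have y: "y < s" "h s y l = 1" "\<And>m. m < y \<Longrightarrow> 2 \<le> h s m l" using that(2) unfolding F_Suc by auto
    have "h t y l = 1" using h_mono[OF that(1), of y l] y(2) by simp
    moreover have "2 \<le> h t m l" if "m < y" for m using h_mono[OF \<open>s \<le> t\<close>, of m l] y(3)[OF that] by simp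
    ultimately show ?thesis using that(1) y(1) unfolding F_Suc by auto
  qed
  have "approximates F (eval (Mn f))"
    unfolding approximates_def
  proof (intro conjI allI impI)
    have N: "computable (\<lambda>z. N (pfst z) (psnd z))"
      unfolding N_def h_def
      by (rule computable_LEAST) (intro computable_intros approximates_computable[OF H], blast)
    show "computable (\<lambda>z. F (pfst z) (psnd z))"
      unfolding F_def h_def by (intro computable_intros approximates_computable[OF H] N)
    show "F t l = Suc y" if "s \<le> t" "F s l = Suc y" for s t l y by (rule F_mono[OF that])
    fix xs n
    show "eval (Mn f) xs n \<longleftrightarrow> (\<exists>s. F s (list_encode xs) = Suc n)"
    proof
      assume "eval (Mn f) xs n"
      then have n: "eval f (n # xs) 0" "\<And>m. m < n \<Longrightarrow> \<exists>y. eval f (m # xs) (Suc y)"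
        by (auto elim: eval_MnE)
      obtain s where s: "h s n (list_encode xs) = 1"
        using n(1) unfolding approximates_iff[OF H] h by auto
      have "\<exists>t. 2 \<le> h t m (list_encode xs)" if m: "m < n" for m
      proof -
        obtain y t where "H t (list_encode (m # xs)) = Suc (Suc y)"
          using n(2)[OF m] unfolding approximates_iff[OF H] by blast
        then have "2 \<le> h t m (list_encode xs)" unfolding h by linarith
        then show ?thesis ..
      qed
      then obtain t where t: "\<And>m. m < n \<Longrightarrow> 2 \<le> h (t m) m (list_encode xs)" by metis
      \<comment> \<open>A stage beyond all the finitely many computations involved; the summand
        \<open>Suc n\<close> secures \<open>n < u\<close>, which \<open>F_Suc\<close>
        demands.\<close>
      define u where "u = Suc n + s + sum t {..<n}"
      have "n < u" "s \<le> u" by (auto simp: u_def)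
      moreover have "t m \<le> u" if "m < n" for m
        using that member_le_sum[of m "{..<n}" t] by (simp add: u_def)
      then have "2 \<le> h u m (list_encode xs)" if "m < n" for m
        using t[OF that] h_mono[of "t m" u m] that by auto
      ultimately have "F u (list_encode xs) = Suc n"
        unfolding F_Suc using s h_mono[of s u n] by auto
      then show "\<exists>s. F s (list_encode xs) = Suc n" by blast
    next
      assume "\<exists>s. F s (list_encode xs) = Suc n"
      then obtain s where s: "h s n (list_encode xs) = 1" "\<And>m. m < n \<Longrightarrow> 2 \<le> h s m (list_encode xs)"
        unfolding F_Suc by blast
      show "eval (Mn f) xs n"
      proof (rule eval_mn)
        show "eval f (n # xs) 0" using s(1) unfolding approximates_iff[OF H] h by auto
        show "\<forall>m<n. \<exists>y. eval f (m # xs) (Suc y)"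
        proof (intro allI impI)
          fix m assume "m < n"
          then have "H s (list_encode (m # xs)) = Suc (Suc (H s (list_encode (m # xs)) - 2))"
            using s(2)[of m] unfolding h by simp
          then show "\<exists>y. eval f (m # xs) (Suc y)" unfolding approximates_iff[OF H] by blast
        qed
      qed
    qed
  qed
  then show ?thesis by blast
qed

text \<open>Plays the part of the Kleene normal form: every \<open>recf\<close> has a total
  computable simulation by stages. It supplies the stages of \<open>A\<close> and of the optimal
  machine.\<close>

theorem eval_approximable: "\<exists>H. approximates H (eval r)"
proof (induction r)
  case Zero
  then show ?case using approximates_Zero by blast
next
  case Succ
  then show ?case using approximates_Succ by blast
next
  case (Proj i)
  then show ?case by (rule approximates_Proj)
next
  case (Comp f gs)
  then show ?case using approximates_Comp by blast
next
  case (Prim f g)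
  then show ?case using approximates_Prim by blast
next
  case (Mn f)
  then show ?case using approximates_Mn by blast
qed

section \<open>Determinism, unbounded search and computably enumerable sets\<close>

lemma eval_deterministic:
  assumes "eval r xs y" "eval r xs z" shows "y = z"
proof -
  obtain H where H: "approximates H (eval r)" using eval_approximable by blast
  \<comment> \<open>At a common stage \<open>H\<close> has only one value.\<close>
  from approximates_max[OF H H assms] show ?thesis by (metis nat.inject)
qed

text \<open>The resulting partial function diverges exactly when the search fails. This gives both
  semidecision procedures and the machines used to compare complexities.\<close>

lemma decidable_search:
  assumes "decidable (\<lambda>z. P (pfst z) (psnd z))" "computable (\<lambda>z. F (pfst z) (psnd z))"
  obtains r where "\<And>x v. eval r [x] v \<longleftrightarrow> (\<exists>y. P x y) \<and> v = F x (LEAST y. P x y)"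
proof -
  obtain p where p: "\<And>x y. eval p [x, y] (prod_encode (x, y))"
    using computable2_pair by (auto simp: computable2_def)
  have "computable (\<lambda>z. 1 - of_bool (P (pfst z) (psnd z)))"
    by (intro computable_intros computable_of_bool assms)
  then obtain q where q: "\<And>z. eval q [z] (1 - of_bool (P (pfst z) (psnd z)))"
    by (auto simp: computable_def)
  obtain f where f: "\<And>z. eval f [z] (F (pfst z) (psnd z))"
    using assms(2) by (auto simp: computable_def)
  define q' where "q' = Comp q [Comp p [Proj 1, Proj 0]]"
  have q': "eval q' [y, x] (1 - of_bool (P x y))" for x y
    using q[of "prod_encode (x, y)"] unfolding q'_def
    by (intro eval_Comp1[OF eval_Comp2[OF _ _ p]] eval_Proj) auto
  define r where "r = Comp f [Comp p [Proj 0, Mn q']]"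
  have f': "eval f [prod_encode (x, y)] (F x y)" for x y
    using f[of "prod_encode (x, y)"] by simp
  have 1: "eval r [x] (F x (LEAST y. P x y))" if "\<exists>y. P x y" for x
  proof -
    have "eval (Mn q') [x] (LEAST y. P x y)"
    proof (rule eval_mn)
      show "eval q' [LEAST y. P x y, x] 0"
        using q'[where x = x and y = "LEAST y. P x y"] LeastI_ex[OF that] by simp
      show "\<forall>m<LEAST y. P x y. \<exists>y. eval q' [m, x] (Suc y)"
      proof (intro allI impI exI)
        fix m assume "m < (LEAST y. P x y)"
        then have "\<not> P x m" by (rule not_less_Least)
        then show "eval q' [m, x] (Suc 0)" using q'[where x = x and y = m] by simp
      qed
    qed
    then show ?thesis unfolding r_def by (intro eval_Comp1[OF eval_Comp2[OF _ _ p] f'] eval_Proj) auto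
  qed
  have 2: "\<exists>y. P x y" if "eval r [x] v" for x v
  proof -
    from that obtain n where "eval (Mn q') [x] n"
      unfolding r_def by (auto elim!: eval_CompE simp: list_all2_Cons1)
    then have "eval q' [n, x] 0" by (auto elim: eval_MnE)
    with q'[where x = x and y = n] have "1 - of_bool (P x n) = (0::nat)" by (rule eval_deterministic)
    then have "P x n" by (cases "P x n") auto
    then show ?thesis ..
  qed
  show thesis using that[of r] 1 2 eval_deterministic by blast
qed

lemma ceI:
  assumes "decidable (\<lambda>z. P (pfst z) (psnd z))" "\<And>x. x \<in> A \<longleftrightarrow> (\<exists>s. P x s)"
  shows "ce A"
proof -
  obtain r where "\<And>x v. eval r [x] v \<longleftrightarrow> (\<exists>y. P x y) \<and> v = 0"
    using decidable_search[OF assms(1) computable_const[of 0]] by blast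
  then show ?thesis unfolding ce_def assms(2) by blast
qed

lemma ce_stages:
  assumes "ce A"
  obtains E where "decidable (\<lambda>z. E (pfst z) (psnd z))" "\<And>x. x \<in> A \<longleftrightarrow> (\<exists>s. E s x)"
    "\<And>s t x. E s x \<Longrightarrow> s \<le> t \<Longrightarrow> E t x"
proof -
  obtain r where r: "\<And>x. x \<in> A \<longleftrightarrow> (\<exists>y. eval r [x] y)" using assms by (auto simp: ce_def)
  obtain H where H: "approximates H (eval r)" using eval_approximable by blast
  show thesis
  proof (rule that)
    show "decidable (\<lambda>z. 0 < H (pfst z) (list_encode [psnd z]))"
      unfolding list_encode.simps by (intro computable_intros approximates_computable[OF H])
    show "x \<in> A \<longleftrightarrow> (\<exists>s. 0 < H s (list_encode [x]))" for x
      unfolding r approximates_iff[OF H] by (metis gr0_implies_Suc zero_less_Suc)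
    show "0 < H t (list_encode [x])" if "0 < H s (list_encode [x])" "s \<le> t" for s t x
      using that approximates_mono[OF H] by (metis gr0_implies_Suc zero_less_Suc)
  qed
qed

section \<open>Coded strings and complexity\<close>

lemma enc_snoc: "enc (bs @ [b]) = enc bs + 2 ^ length bs * (if b then 2 else 1)"
  by (induction bs rule: enc.induct) auto

lemma enc_bounds: "2 ^ length bs \<le> enc bs + 1" "enc bs + 1 < 2 ^ Suc (length bs)"
  by (induction bs rule: enc.induct) auto

text \<open>The code 0 belongs to the empty string only; otherwise parity gives the first bit, odd
  for \<open>False\<close> and even for \<open>True\<close>.\<close>

lemma enc_inject: "enc bs = enc cs \<longleftrightarrow> bs = cs"
proof
  show "enc bs = enc cs \<Longrightarrow> bs = cs"
  proof (induction bs arbitrary: cs rule: enc.induct)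
    case 1
    then show ?case by (cases cs) (auto split: if_splits)
  next
    case (2 b bs)
    show ?case
    proof (cases cs)
      case Nil
      with 2 show ?thesis by (auto split: if_splits)
    next
      case (Cons c cs')
      with 2(2) have "2 * enc bs + (if b then 2 else 1) = 2 * enc cs' + (if c then 2 else 1)" by simp
      then have "b = c" by (cases b; cases c; simp; presburger)
      with 2 Cons show ?thesis by simp
    qed
  qed
qed simp

text \<open>Needed so that any numerical input or output of a \<open>recf\<close> can be read as a
  string.\<close>

lemma enc_surj: "\<exists>bs. v = enc bs"
proof (induction v rule: less_induct)
  case (less v)
  consider "v = 0" | q where "v = 2 * q + 1" | q where "v = 2 * q + 2"
    by (metis One_nat_def Suc_eq_plus1 evenE mult_0_right mult_Suc_right not0_implies_Suc oddE add.commute)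
  then show ?case
  proof cases
    case 1
    then show ?thesis by (metis enc.simps(1))
  next
    case (2 q)
    with less obtain bs where "q = enc bs" by fastforce
    with 2 have "v = enc (False # bs)" by simp
    then show ?thesis ..
  next
    case (3 q)
    with less obtain bs where "q = enc bs" by fastforce
    with 3 have "v = enc (True # bs)" by simp
    then show ?thesis ..
  qed
qed

text \<open>The codes \<open>v\<close> of strings of length \<open>n\<close> are those with
  \<open>2 ^ n \<le> v + 1 < 2 ^ Suc n\<close>.\<close>

definition strlen :: "nat \<Rightarrow> nat" where
  "strlen v = (LEAST n. v + 1 < 2 ^ Suc n)"

lemma strlen_enc [simp]: "strlen (enc bs) = length bs"
  unfolding strlen_def
proof (rule Least_equality)
  fix n assume "enc bs + 1 < 2 ^ Suc n"
  with enc_bounds(1)[of bs] have "(2::nat) ^ length bs < 2 ^ Suc n" by linarith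
  then show "length bs \<le> n" by (simp only: power_strict_increasing_iff one_less_numeral_iff semiring_norm less_Suc_eq_le)
qed (rule enc_bounds)

lemma computable_strlen [computable_intros]:
  assumes "computable f" shows "computable (\<lambda>x. strlen (f x))"
proof (rule computable_comp[OF _ assms])
  have "\<exists>n. x + 1 < 2 ^ Suc n" for x :: nat using enc_surj[of x] enc_bounds(2) by blast
  then show "computable strlen"
    unfolding strlen_def by (intro computable_LEAST computable_intros)
qed

text \<open>In the bijective base-2 code, a string of length \<open>n\<close> is \<open>2 ^ n - 1\<close> plus its value as an
  ordinary binary number.\<close>
definition seg_code :: "(nat \<Rightarrow> bool) \<Rightarrow> nat \<Rightarrow> nat" where
  "seg_code P n = 2 ^ n - 1 + set_encode {x. x < n \<and> P x}"

lemma length_init_seg [simp]: "length (init_seg Y n) = n"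
  by (simp add: init_seg_def)

lemma enc_init_seg: "enc (init_seg Y n) = seg_code (\<lambda>x. x \<in> Y) n"
proof (induction n)
  case 0
  show ?case by (simp add: init_seg_def seg_code_def)
next
  case (Suc n)
  have "init_seg Y (Suc n) = init_seg Y n @ [n \<in> Y]" by (simp add: init_seg_def)
  moreover have "{x. x < Suc n \<and> x \<in> Y} = (if n \<in> Y then insert n else id) {x. x < n \<and> x \<in> Y}"
    by (auto simp: less_Suc_eq)
  moreover have "Suc 0 \<le> 2 ^ n" by simp
  ultimately show ?case using Suc by (cases "n \<in> Y") (simp_all add: enc_snoc seg_code_def)
qed

lemma seg_code_cong: "(\<And>x. x < n \<Longrightarrow> P x = Q x) \<Longrightarrow> seg_code P n = seg_code Q n"
  unfolding seg_code_def by (metis (mono_tags, lifting))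

lemma seg_code_eqD:
  assumes "seg_code P n = seg_code Q n" "x < n" shows "P x = Q x"
proof -
  have "set_encode {x. x < n \<and> P x} = set_encode {x. x < n \<and> Q x}"
    using assms(1) unfolding seg_code_def by (simp only: add_left_cancel)
  then have "{x. x < n \<and> P x} = {x. x < n \<and> Q x}" by (subst (asm) set_encode_eq) simp_all
  with assms(2) show ?thesis by blast
qed

lemma computable_seg_code [computable_intros]:
  assumes "computable n" "decidable (\<lambda>z. P (pfst z) (psnd z))"
  shows "computable (\<lambda>x. seg_code (P x) (n x))"
  unfolding seg_code_def by (intro computable_intros assms)

section \<open>Sufficient conditions for \<open>K_le\<close>\<close>

lemma K_le_trans: "K_le U Y Z \<Longrightarrow> K_le U Z W \<Longrightarrow> K_le U Y W"
proof -
  assume "K_le U Y Z" "K_le U Z W"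
  then obtain c d where c: "\<And>n. KM U (init_seg Y n) \<le> KM U (init_seg Z n) + enat c"
    and d: "\<And>n. KM U (init_seg Z n) \<le> KM U (init_seg W n) + enat d"
    unfolding K_le_def by blast
  have "KM U (init_seg Y n) \<le> KM U (init_seg W n) + enat (d + c)" for n
  proof -
    have "KM U (init_seg Z n) + enat c \<le> KM U (init_seg W n) + enat d + enat c"
      using d by (rule add_right_mono)
    with c[of n] show ?thesis
      by (metis add.assoc order_trans plus_enat_simps(1))
  qed
  then show "K_le U Y W" unfolding K_le_def by blast
qed

text \<open>If the initial segments of \<open>Y\<close> are computable from those of \<open>Z\<close>, then running the optimal
  machine followed by this computation is a prefix-free machine, since its domain is contained in
  the domain of the optimal machine.\<close>
lemma K_le_search:
  assumes U: "optimal_pf_machine U"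
    and P: "decidable (\<lambda>z. P (pfst z) (psnd z))" and F: "computable (\<lambda>z. F (pfst z) (psnd z))"
    and ex: "\<And>n. \<exists>y. P (enc (init_seg Z n)) y"
    and val: "\<And>n y. P (enc (init_seg Z n)) y \<Longrightarrow> F (enc (init_seg Z n)) y = enc (init_seg Y n)"
  shows "K_le U Y Z"
proof -
  obtain r where r: "\<And>x v. eval r [x] v \<longleftrightarrow> (\<exists>y. P x y) \<and> v = F x (LEAST y. P x y)"
    using decidable_search[OF P F] by blast
  obtain q where q: "\<And>\<tau> \<sigma>. eval q [enc \<tau>] (enc \<sigma>) \<longleftrightarrow> U \<tau> = Some \<sigma>"
    using U by (auto simp: optimal_pf_machine_def prefix_free_machine_def partial_computable_machine_def)
  define R where "R \<tau> \<sigma> \<longleftrightarrow> eval (Comp r [q]) [enc \<tau>] (enc \<sigma>)" for \<tau> \<sigma>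
  have R_unique: "R \<tau> \<sigma> \<Longrightarrow> R \<tau> \<sigma>' \<Longrightarrow> \<sigma> = \<sigma>'" for \<tau> \<sigma> \<sigma>'
    unfolding R_def using eval_deterministic enc_inject by metis
  define M where "M \<tau> = (if \<exists>\<sigma>. R \<tau> \<sigma> then Some (SOME \<sigma>. R \<tau> \<sigma>) else None)" for \<tau>
  have M: "M \<tau> = Some \<sigma> \<longleftrightarrow> R \<tau> \<sigma>" for \<tau> \<sigma>
    using someI[of "R \<tau>" \<sigma>] someI_ex[of "R \<tau>"] R_unique by (auto simp: M_def)
  have dom: "U \<tau> \<noteq> None" if "M \<tau> \<noteq> None" for \<tau>
  proof -
    from that obtain \<sigma> where "eval (Comp r [q]) [enc \<tau>] (enc \<sigma>)" by (auto simp: M R_def)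
    then obtain v where v: "eval q [enc \<tau>] v" by (auto elim!: eval_CompE simp: list_all2_Cons1)
    obtain \<rho> where "v = enc \<rho>" using enc_surj by blast
    with v q show ?thesis by simp
  qed
  have "partial_computable_machine M"
    unfolding partial_computable_machine_def M R_def by blast
  moreover have "\<forall>\<tau> \<tau>'. U \<tau> \<noteq> None \<longrightarrow> U \<tau>' \<noteq> None \<longrightarrow> prefix \<tau> \<tau>' \<longrightarrow> \<tau> = \<tau>'"
    using U unfolding optimal_pf_machine_def prefix_free_machine_def by blast
  ultimately have "prefix_free_machine M" using dom unfolding prefix_free_machine_def by blast
  then obtain c where c: "\<And>\<sigma>. KM U \<sigma> \<le> KM M \<sigma> + enat c"
    using U unfolding optimal_pf_machine_def by blast
  have "KM M (init_seg Y n) \<le> KM U (init_seg Z n)" for n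
    unfolding KM_def
  \<comment> \<open>Every \<open>U\<close>-description of the segment of \<open>Z\<close> is an
    \<open>M\<close>-description of that of \<open>Y\<close>, so the second infimum ranges over at
    least as many lengths.\<close>
  proof (rule Inf_superset_mono, safe)
    fix \<tau> assume "U \<tau> = Some (init_seg Z n)"
    then have "eval q [enc \<tau>] (enc (init_seg Z n))" by (simp add: q)
    moreover have "eval r [enc (init_seg Z n)] (enc (init_seg Y n))"
      unfolding r using ex[of n] val[OF LeastI_ex[OF ex[of n]]] by simp
    ultimately have "M \<tau> = Some (init_seg Y n)" unfolding M R_def by (rule eval_Comp1)
    then show "\<exists>\<tau>'. enat (length \<tau>) = enat (length \<tau>') \<and> M \<tau>' = Some (init_seg Y n)" by blast
  qed
  then have "KM U (init_seg Y n) \<le> KM U (init_seg Z n) + enat c" for n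
    using c[of "init_seg Y n"] by (meson add_right_mono order_trans)
  then show ?thesis unfolding K_le_def by blast
qed

text \<open>A segment of \<open>Z\<close> is used only for its length, from which the segment of
  \<open>Y\<close> is computed outright; the search is therefore trivial. With \<open>Z\<close>
  empty this says that decidable sets are \<open>K\<close>-trivial.\<close>

lemma K_le_decidable:
  assumes "optimal_pf_machine U" "decidable (\<lambda>x. x \<in> Y)"
  shows "K_le U Y Z"
proof (rule K_le_search[OF assms(1), where P = "\<lambda>_ _. True" and F = "\<lambda>v _. seg_code (\<lambda>x. x \<in> Y) (strlen v)"])
  show "computable (\<lambda>z. seg_code (\<lambda>x. x \<in> Y) (strlen (pfst z)))"
    by (intro computable_intros decidable_comp[OF assms(2)])
qed (simp_all add: enc_init_seg computable_intros flip: enc_init_seg)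

lemma K_le_Un_decidable:
  assumes "optimal_pf_machine U" "decidable (\<lambda>x. x \<in> C)"
  shows "K_le U (Y \<union> C) Y"
proof (rule K_le_search[OF assms(1), where P = "\<lambda>_ _. True"
      and F = "\<lambda>v _. seg_code (\<lambda>x. x \<in> set_decode (v - (2 ^ strlen v - 1)) \<or> x \<in> C) (strlen v)"])
  show "computable (\<lambda>z. seg_code (\<lambda>x. x \<in> set_decode (pfst z - (2 ^ strlen (pfst z) - 1)) \<or> x \<in> C) (strlen (pfst z)))"
    by (intro computable_intros decidable_comp[OF assms(2)])
  fix n
  let ?v = "enc (init_seg Y n)"
  have len: "strlen ?v = n" by simp
  \<comment> \<open>Removing the offset \<open>2 ^ n - 1\<close> from the string code leaves the
    code of the finite set of elements of \<open>Y\<close> below \<open>n\<close>.\<close>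
  have dec: "set_decode (?v - (2 ^ n - 1)) = {x. x < n \<and> x \<in> Y}"
    unfolding enc_init_seg seg_code_def by (simp del: One_nat_def)
  show "seg_code (\<lambda>x. x \<in> set_decode (?v - (2 ^ strlen ?v - 1)) \<or> x \<in> C) (strlen ?v) = enc (init_seg (Y \<union> C) n)"
    unfolding len dec unfolding enc_init_seg by (rule seg_code_cong) simp
qed (simp_all add: computable_intros)

text \<open>\<open>K_stage H s v\<close> is the complexity of the string coded by \<open>v\<close> as seen at stage \<open>s\<close>, with the
  default \<open>s\<close>, which tends to infinity.\<close>
definition K_stage :: "(nat \<Rightarrow> nat \<Rightarrow> nat) \<Rightarrow> nat \<Rightarrow> nat \<Rightarrow> nat" where
  "K_stage H s v = (LEAST k. k = s \<or> (\<exists>t<s. H s (list_encode [t]) = Suc v \<and> strlen t = k))"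

lemma computable_K_stage:
  assumes "approximates H E" "computable f" "computable g"
  shows "computable (\<lambda>x. K_stage H (f x) (g x))"
proof (rule computable_uncurry[OF _ assms(2,3)])
  show "computable (\<lambda>z. K_stage H (pfst z) (psnd z))"
    unfolding K_stage_def list_encode.simps
  proof (rule computable_LEAST)
    show "\<exists>k. k = pfst x \<or> (\<exists>t<pfst x. H (pfst x) (Suc (prod_encode (t, 0))) = Suc (psnd x) \<and> strlen t = k)" for x
      by blast
  qed (intro computable_intros approximates_computable[OF assms(1)])
qed

lemma K_stage_le: "K_stage H s v \<le> s"
  unfolding K_stage_def by (rule Least_le) simp

section \<open>Convergence of the stage complexity\<close>

context
  fixes U H q
  assumes q: "\<And>\<tau> \<sigma>. eval q [enc \<tau>] (enc \<sigma>) \<longleftrightarrow> U \<tau> = Some \<sigma>" and H: "approximates H (eval q)"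
begin

lemma machine_stage: "U \<tau> = Some \<sigma> \<longleftrightarrow> (\<exists>s. H s (list_encode [enc \<tau>]) = Suc (enc \<sigma>))"
  using q approximates_iff[OF H] by blast

text \<open>A stage value other than the default is the length of a genuine description, so it never
  undercuts the true complexity.\<close>

lemma K_stage_cases:
  obtains "K_stage H s (enc \<sigma>) = s" | \<tau> where "U \<tau> = Some \<sigma>" "K_stage H s (enc \<sigma>) = length \<tau>"
proof -
  let ?k = "K_stage H s (enc \<sigma>)"
  have "?k = s \<or> (\<exists>t<s. H s (list_encode [t]) = Suc (enc \<sigma>) \<and> strlen t = ?k)"
    unfolding K_stage_def by (rule LeastI[of _ s]) simp
  then show thesis
  proof
    assume "\<exists>t<s. H s (list_encode [t]) = Suc (enc \<sigma>) \<and> strlen t = ?k"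
    then obtain t where t: "H s (list_encode [t]) = Suc (enc \<sigma>)" "strlen t = ?k" by blast
    obtain \<tau> where \<tau>: "t = enc \<tau>" using enc_surj by blast
    have "U \<tau> = Some \<sigma>" using t(1) unfolding machine_stage \<tau> by blast
    moreover have "?k = length \<tau>" using t(2) \<tau> by simp
    ultimately show thesis by (rule that(2))
  qed (rule that(1))
qed

lemma K_stage_infinity:
  assumes "KM U \<sigma> = \<infinity>" shows "K_stage H s (enc \<sigma>) = s"
proof (cases rule: K_stage_cases[of s \<sigma>])
  case (2 \<tau>)
  then have "KM U \<sigma> \<le> enat (length \<tau>)" unfolding KM_def by (blast intro: Inf_lower)
  with assms show ?thesis by simp
qed

lemma eventually_K_stage:
  assumes "KM U \<sigma> = enat k" shows "\<forall>\<^sub>F s in at_top. K_stage H s (enc \<sigma>) = k"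
proof -
  let ?A = "{enat (length \<tau>) |\<tau>. U \<tau> = Some \<sigma>}"
  have "?A \<noteq> {}" using assms by (auto simp: KM_def Inf_enat_def split: if_splits)
  then have "KM U \<sigma> \<in> ?A"
    unfolding KM_def Inf_enat_def by (simp only: if_False) (rule LeastI_ex, blast)
  then have "enat k \<in> ?A" unfolding assms .
  then obtain \<tau> where \<tau>: "U \<tau> = Some \<sigma>" "length \<tau> = k" by auto
  then obtain s0 where s0: "H s0 (list_encode [enc \<tau>]) = Suc (enc \<sigma>)" using machine_stage by blast
  \<comment> \<open>From this stage on the shortest description has converged, its code lies within
    the search bound, and the default \<open>s\<close> exceeds \<open>k\<close>.\<close>
  have "K_stage H s (enc \<sigma>) = k" if "s \<ge> Suc (s0 + enc \<tau> + k)" for s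
  proof (rule antisym)
    have "H s (list_encode [enc \<tau>]) = Suc (enc \<sigma>)" by (rule approximates_mono[OF H s0]) (use that in simp)
    moreover have "enc \<tau> < s" using that by simp
    ultimately show "K_stage H s (enc \<sigma>) \<le> k"
      unfolding K_stage_def using \<tau>(2) by (intro Least_le) (metis strlen_enc)
    show "k \<le> K_stage H s (enc \<sigma>)"
    proof (cases rule: K_stage_cases[of s \<sigma>])
      case 1
      then show ?thesis using that by simp
    next
      case (2 \<rho>)
      then have "KM U \<sigma> \<le> enat (length \<rho>)" unfolding KM_def by (blast intro: Inf_lower)
      with assms 2(2) show ?thesis by simp
    qed
  qed
  then show ?thesis unfolding eventually_at_top_linorder by blast
qed

text \<open>Infinite complexities are covered by the default: if \<open>KM U \<rho>\<close> is
  infinite, the stage inequality holds always since no value exceeds \<open>s\<close>; if only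
  \<open>KM U \<sigma>\<close> is, it fails once \<open>s > k + c\<close>.\<close>

lemma eventually_K_stage_le_iff:
  "\<forall>\<^sub>F s in at_top. K_stage H s (enc \<sigma>) \<le> K_stage H s (enc \<rho>) + c \<longleftrightarrow> KM U \<sigma> \<le> KM U \<rho> + enat c"
proof (cases "KM U \<rho>")
  case (enat k)
  show ?thesis
  proof (cases "KM U \<sigma>")
    case (enat j)
    show ?thesis
      using eventually_K_stage[OF \<open>KM U \<rho> = enat k\<close>] eventually_K_stage[OF enat]
      by eventually_elim (simp add: enat \<open>KM U \<rho> = enat k\<close>)
  next
    case infinity
    show ?thesis
      using eventually_K_stage[OF enat] eventually_gt_at_top[of "k + c"]
      by eventually_elim (simp add: enat infinity K_stage_infinity)
  qed
next
  case infinity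
  then show ?thesis
    by (simp add: K_stage_infinity K_stage_le trans_le_add1)
qed

end

section \<open>Limit computable sets\<close>

text \<open>One direction of the limit lemma. \<open>L s x\<close> asks for a candidate witness
  \<open>y\<close> of the Sigma form, unrefuted so far, with the Pi form confirmed below
  \<open>y\<close>. If \<open>x\<close> is not in \<open>X\<close>, the Pi form fails at some
  \<open>y\<close>, so only candidates up to \<open>y\<close> qualify, and all of these are
  eventually refuted.\<close>

lemma delta02_limit:
  assumes "delta02 X"
  obtains L where "decidable (\<lambda>z. L (pfst z) (psnd z))" "\<And>x. \<forall>\<^sub>F s in at_top. L s x \<longleftrightarrow> x \<in> X"
proof -
  obtain R S where R: "computable_rel3 R" "\<And>x. x \<in> X \<longleftrightarrow> (\<exists>y. \<forall>z. R x y z)"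
    and S: "computable_rel3 S" "\<And>x. x \<in> X \<longleftrightarrow> (\<forall>y. \<exists>z. S x y z)"
    using assms unfolding delta02_def sigma02_def pi02_def by blast
  have rel3: "decidable (\<lambda>x. Q (f x) (g x) (h x))"
    if Q: "computable_rel3 Q" and fgh: "computable f" "computable g" "computable h" for Q f g h
  proof -
    obtain r where "\<And>x y z. eval r [x, y, z] (if Q x y z then 1 else 0)"
      using Q unfolding computable_rel3_def by blast
    then have r: "\<And>x y z. eval r [x, y, z] (of_bool (Q x y z))" by (simp add: of_bool_def)
    obtain rf rg rh where "\<And>x. eval rf [x] (f x)" "\<And>x. eval rg [x] (g x)" "\<And>x. eval rh [x] (h x)"
      using fgh by (auto simp: computable_def)
    then have "eval (Comp r [rf, rg, rh]) [x] (of_bool (Q (f x) (g x) (h x)))" for x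
      by (intro eval_Comp3[OF _ _ _ r])
    then show ?thesis unfolding decidable_def computable_def by blast
  qed
  define L where "L s x \<longleftrightarrow> (\<exists>y<s. (\<forall>z<s. R x y z) \<and> (\<forall>w<y. \<exists>z<s. S x w z))" for s x
  show thesis
  proof (rule that)
    show "decidable (\<lambda>z. L (pfst z) (psnd z))"
      unfolding L_def by (intro computable_intros rel3 R(1) S(1))
    fix x
    have all: "\<forall>\<^sub>F s in at_top. \<forall>w\<in>{..<b}. \<exists>z<s. Q w z" if "\<And>w. w < b \<Longrightarrow> \<exists>z. Q w z" for b :: nat and Q :: "nat \<Rightarrow> nat \<Rightarrow> bool"
    proof (intro eventually_ball_finite ballI)
      fix w assume "w \<in> {..<b}"
      then have "\<exists>z. Q w z" using that by simp
      then obtain z where z: "Q w z" ..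
      show "\<forall>\<^sub>F s in at_top. \<exists>z<s. Q w z"
        using eventually_gt_at_top[of z] by eventually_elim (use z in blast)
    qed simp
    show "\<forall>\<^sub>F s in at_top. L s x \<longleftrightarrow> x \<in> X"
    proof (cases "x \<in> X")
      case True
      then obtain y where y: "\<And>z. R x y z" using R(2) by blast
      have "\<exists>z. S x w z" for w using True S(2) by blast
      then have "\<forall>\<^sub>F s in at_top. \<forall>w\<in>{..<y}. \<exists>z<s. S x w z" by (intro all)
      with eventually_gt_at_top[of y] show ?thesis
        by eventually_elim (use True y in \<open>auto simp: L_def\<close>)
    next
      case False
      then obtain y where y: "\<And>z. \<not> S x y z" using S(2) by blast
      have "\<exists>z. \<not> R x w z" for w using False R(2) by blast
      then have "\<forall>\<^sub>F s in at_top. \<forall>w\<in>{..<Suc y}. \<exists>z<s. \<not> R x w z" by (intro all)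
      then show ?thesis
      proof eventually_elim
        case (elim s)
        have "\<not> L s x"
        proof
          assume "L s x"
          then obtain v where v: "\<And>z. z < s \<Longrightarrow> R x v z" "\<And>w. w < v \<Longrightarrow> \<exists>z<s. S x w z"
            unfolding L_def by blast
          then have "\<not> y < v" using y by blast
          then have "v \<in> {..<Suc y}" by simp
          with elim v(1) show False by blast
        qed
        with False show ?case by simp
      qed
    qed
  qed
qed

section \<open>The splitting construction\<close>

text \<open>A state is the code of a finite set of pairs: \<open>(0, x)\<close> and \<open>(1, x)\<close> put \<open>x\<close> into \<open>A0\<close> and
  \<open>A1\<close>, and \<open>(e + 2, m)\<close> records that requirement \<open>e\<close> protects \<open>m\<close>. Requirement \<open>e\<close> refutes that
  \<open>K (Y\<restriction>n) \<le> K (A\<^sub>i\<restriction>n) + e div 4\<close> for all \<open>n\<close>, where \<open>i = e mod 2\<close>, and \<open>Y\<close> is \<open>X\<close> or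
  \<open>A\<^sub>1\<^sub>-\<^sub>i\<close> according to \<open>e mod 4\<close>.\<close>

definition mem :: "nat \<Rightarrow> nat \<Rightarrow> nat \<Rightarrow> bool" where
  "mem i S x \<longleftrightarrow> prod_encode (i, x) \<in> set_decode S"

lemma decidable_mem [computable_intros]:
  "computable f \<Longrightarrow> computable g \<Longrightarrow> computable h \<Longrightarrow> decidable (\<lambda>x. mem (f x) (g x) (h x))"
  unfolding mem_def by (intro computable_intros)

text \<open>Even requirements protect side 0, so \<open>x\<close> is sent to side 1 when the
  strongest requirement protecting it is even. The bound \<open>s\<close> loses nothing for
  \<open>S = state s\<close>, whose pairs have codes below \<open>s\<close>.\<close>

definition diverted :: "nat \<Rightarrow> nat \<Rightarrow> nat \<Rightarrow> bool" where
  "diverted s S x \<longleftrightarrow> (\<exists>e<s. e mod 2 = 0 \<and> mem (e + 2) S x \<and> (\<forall>d<e. \<not> mem (d + 2) S x))"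

locale splitting =
  fixes U :: "bool list \<Rightarrow> bool list option" and A X :: "nat set"
    and E L :: "nat \<Rightarrow> nat \<Rightarrow> bool" and q :: recf and H :: "nat \<Rightarrow> nat \<Rightarrow> nat"
  assumes U: "optimal_pf_machine U"
    and q: "\<And>\<tau> \<sigma>. eval q [enc \<tau>] (enc \<sigma>) \<longleftrightarrow> U \<tau> = Some \<sigma>" and H: "approximates H (eval q)"
    and E_decidable: "decidable (\<lambda>z. E (pfst z) (psnd z))"
    and E_iff: "\<And>x. x \<in> A \<longleftrightarrow> (\<exists>s. E s x)" and E_mono: "\<And>s t x. E s x \<Longrightarrow> s \<le> t \<Longrightarrow> E t x"
    and L_decidable: "decidable (\<lambda>z. L (pfst z) (psnd z))"
    and L_limit: "\<And>x. \<forall>\<^sub>F s in at_top. L s x \<longleftrightarrow> x \<in> X"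
    and A_nontrivial: "\<not> K_le U A {}" and X_nontrivial: "\<not> K_le U X {}"
begin

definition target :: "nat \<Rightarrow> nat \<Rightarrow> nat \<Rightarrow> nat \<Rightarrow> bool" where
  "target s S e x = (if e mod 4 < 2 then L s x else mem (1 - e mod 2) S x)"

definition agrees :: "nat \<Rightarrow> nat \<Rightarrow> nat \<Rightarrow> nat \<Rightarrow> bool" where
  "agrees s S e m \<longleftrightarrow>
     K_stage H s (seg_code (target s S e) m) \<le> K_stage H s (seg_code (mem (e mod 2) S) m) + e div 4"

definition enters :: "nat \<Rightarrow> nat \<Rightarrow> nat \<Rightarrow> nat \<Rightarrow> bool" where
  "enters s S i x \<longleftrightarrow> E s x \<and> \<not> mem 0 S x \<and> \<not> mem 1 S x \<and> (if diverted s S x then i = 1 else i = 0)"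

definition step :: "nat \<Rightarrow> nat \<Rightarrow> nat \<Rightarrow> bool" where
  "step s S z = (if pfst z < 2 then enters s S (pfst z) (psnd z)
     else \<forall>m<Suc (psnd z). agrees s S (pfst z - 2) m)"

text \<open>Nothing is ever removed. The bound \<open>z < Suc s\<close> keeps the state finite,
  hence codable; a pair only has to wait until the stage reaches its code.\<close>

primrec state :: "nat \<Rightarrow> nat" where
  "state 0 = 0"
| "state (Suc s) = set_encode {z. z < Suc s \<and> (z \<in> set_decode (state s) \<or> step s (state s) z)}"

lemma decidable_target:
  assumes "computable f" "computable g" "computable h" "computable k"
  shows "decidable (\<lambda>x. target (f x) (g x) (h x) (k x))"
  unfolding target_def by (intro computable_intros decidable_uncurry[OF L_decidable] assms)

lemma decidable_step:
  "decidable (\<lambda>z. step (pfst (pfst z)) (psnd (pfst z)) (psnd z))"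
  unfolding step_def enters_def diverted_def agrees_def
  by (intro computable_intros decidable_uncurry[OF E_decidable] decidable_target computable_K_stage[OF H])

lemma computable_state:
  assumes "computable f" shows "computable (\<lambda>x. state (f x))"
proof (rule computable_comp[OF _ assms])
  have *: "state s = rec_nat 0 (\<lambda>s S. set_encode {z. z < Suc s \<and> (z \<in> set_decode S \<or> step s S z)}) s" for s
    by (induction s) auto
  have "decidable (\<lambda>z. step (pfst (psnd (pfst z))) (psnd (psnd (pfst z))) (psnd z))"
    using decidable_comp[OF decidable_step, of "\<lambda>z. prod_encode (psnd (pfst z), psnd z)"] by (simp add: computable_intros)
  then show "computable state"
    unfolding * by (intro computable_rec_nat computable_intros)
qed

text \<open>\<open>B 0\<close> and \<open>B 1\<close> are the two halves of \<open>A\<close>, and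
  \<open>B (e + 2)\<close> is the set of numbers ever protected by requirement
  \<open>e\<close>.\<close>

definition B :: "nat \<Rightarrow> nat set" where
  "B i = {x. \<exists>s. mem i (state s) x}"

lemma mem_less: "mem i (state s) x \<Longrightarrow> prod_encode (i, x) < s"
  by (cases s) (auto simp: mem_def)

lemma mem_Suc:
  "mem i (state (Suc s)) x \<longleftrightarrow>
     mem i (state s) x \<or> prod_encode (i, x) \<le> s \<and> step s (state s) (prod_encode (i, x))"
  using mem_less[of i s x] by (auto simp: mem_def less_Suc_eq_le simp del: state.simps(1))

declare state.simps(2) [simp del]

lemma mem_Suc_enters:
  "i < 2 \<Longrightarrow> mem i (state (Suc s)) x \<longleftrightarrow>
     mem i (state s) x \<or> prod_encode (i, x) \<le> s \<and> enters s (state s) i x"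
  unfolding mem_Suc by (simp add: step_def)

lemma mem_Suc_agrees:
  "mem (e + 2) (state (Suc s)) m \<longleftrightarrow>
     mem (e + 2) (state s) m \<or> prod_encode (e + 2, m) \<le> s \<and> (\<forall>n\<le>m. agrees s (state s) e n)"
  unfolding mem_Suc by (simp add: step_def less_Suc_eq_le)

lemma mem_mono:
  assumes "mem i (state s) x" "s \<le> t" shows "mem i (state t) x"
  using assms(2,1) by (induction rule: dec_induct) (auto simp: mem_Suc)

lemma mem_new:
  assumes "x \<in> B i" "\<not> mem i (state s) x"
  obtains t where "s \<le> t" "\<not> mem i (state t) x" "mem i (state (Suc t)) x"
proof -
  obtain u where u: "mem i (state u) x" using assms(1) by (auto simp: B_def)
  have "s \<le> u" using assms(2) mem_mono[OF u, of s] by linarith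
  then have "\<exists>t\<ge>s. \<not> mem i (state t) x \<and> mem i (state (Suc t)) x"
    using u
  proof (induction u rule: dec_induct)
    case base
    with assms(2) show ?case by simp
  next
    case (step n)
    then show ?case by (cases "mem i (state n) x") auto
  qed
  then show thesis using that by blast
qed

lemma eventually_mem: "\<forall>\<^sub>F s in at_top. mem i (state s) x \<longleftrightarrow> x \<in> B i"
proof (cases "x \<in> B i")
  case True
  then obtain s where s: "mem i (state s) x" by (auto simp: B_def)
  show ?thesis using eventually_ge_at_top[of s] by eventually_elim (use mem_mono[OF s] True in blast)
next
  case False
  then show ?thesis by (auto simp: B_def)
qed

section \<open>The halves partition \<open>A\<close> and are computably enumerable\<close>

lemma B_disjoint: "B 0 \<inter> B 1 = {}"
proof -
  have *: "\<not> (mem 0 (state s) x \<and> mem 1 (state s) x)" for s x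
  proof (induction s)
    case 0
    show ?case by (simp add: mem_def)
  next
    case (Suc s)
    then show ?case by (auto simp: mem_Suc_enters enters_def)
  qed
  show ?thesis
  proof (rule ccontr)
    assume "B 0 \<inter> B 1 \<noteq> {}"
    then obtain x s t where "mem 0 (state s) x" "mem 1 (state t) x" unfolding B_def by blast
    then have "mem 0 (state (max s t)) x" "mem 1 (state (max s t)) x"
      by (auto intro: mem_mono)
    with * show False by blast
  qed
qed

lemma A_eq: "A = B 0 \<union> B 1"
proof (intro equalityI subsetI)
  fix x assume "x \<in> A"
  then obtain s0 where s0: "E s0 x" using E_iff by blast
  \<comment> \<open>By this stage \<open>x\<close> has been enumerated into \<open>A\<close> and its
    pairs for both sides have become eligible.\<close>
  define s where "s = s0 + prod_encode (0, x) + prod_encode (1, x)"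
  have E: "E s x" using E_mono[OF s0] by (simp add: s_def)
  define i :: nat where "i = (if diverted s (state s) x then 1 else 0)"
  have "prod_encode (i, x) \<le> s" by (simp add: i_def s_def)
  then have "mem 0 (state s) x \<or> mem 1 (state s) x \<or> mem i (state (Suc s)) x"
    using E mem_Suc_enters[of i s x] by (auto simp: enters_def i_def)
  then show "x \<in> B 0 \<union> B 1" by (auto simp: B_def i_def split: if_splits)
next
  have *: "mem i (state s) x \<Longrightarrow> i < 2 \<Longrightarrow> x \<in> A" for i s x
  proof (induction s)
    case 0
    then show ?case by (simp add: mem_def)
  next
    case (Suc s)
    then show ?case using E_iff by (auto simp: mem_Suc_enters enters_def)
  qed
  fix x assume "x \<in> B 0 \<union> B 1"
  then show "x \<in> A" using *[of 0] *[of 1] by (auto simp: B_def)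
qed

lemma ce_B: "ce (B i)"
proof (rule ceI[where P = "\<lambda>x s. mem i (state s) x"])
  show "decidable (\<lambda>z. mem i (state (psnd z)) (pfst z))"
    by (intro computable_intros computable_state)
qed (simp add: B_def)

section \<open>Outcomes of the requirements\<close>

definition Y :: "nat \<Rightarrow> nat set" where
  "Y e = (if e mod 4 < 2 then X else B (1 - e mod 2))"

definition holds :: "nat \<Rightarrow> nat \<Rightarrow> bool" where
  "holds e m \<longleftrightarrow> KM U (init_seg (Y e) m) \<le> KM U (init_seg (B (e mod 2)) m) + enat (e div 4)"

lemma eventually_seg_code:
  assumes "\<And>x. \<forall>\<^sub>F s in at_top. P s x \<longleftrightarrow> x \<in> Z"
  shows "\<forall>\<^sub>F s in at_top. seg_code (P s) m = enc (init_seg Z m)"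
proof -
  have "\<forall>\<^sub>F s in at_top. \<forall>x\<in>{..<m}. P s x \<longleftrightarrow> x \<in> Z"
    using assms by (intro eventually_ball_finite) auto
  then show ?thesis unfolding enc_init_seg by eventually_elim (auto intro: seg_code_cong)
qed

lemma eventually_agrees: "\<forall>\<^sub>F s in at_top. agrees s (state s) e m \<longleftrightarrow> holds e m"
proof -
  have "\<forall>\<^sub>F s in at_top. target s (state s) e x \<longleftrightarrow> x \<in> Y e" for x
    using L_limit[of x] eventually_mem[of "1 - e mod 2" x] by (simp add: target_def Y_def)
  note target = eventually_seg_code[OF this, of m]
  note B = eventually_seg_code[OF eventually_mem, of "e mod 2" m]
  show ?thesis
    using target B eventually_K_stage_le_iff[OF q H, of "init_seg (Y e) m" "init_seg (B (e mod 2)) m" "e div 4"]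
    by eventually_elim (simp add: agrees_def holds_def)
qed

text \<open>Some number above \<open>m\<close> is first protected after the truth of the inequality
  at \<open>m\<close> has stabilized, and protecting it requires the stage inequality at
  \<open>m\<close>.\<close>

lemma infinite_marks_holds:
  assumes "infinite (B (e + 2))" shows "holds e m"
proof -
  obtain N where N: "\<And>s. N \<le> s \<Longrightarrow> agrees s (state s) e m \<longleftrightarrow> holds e m"
    using eventually_agrees[of e m] unfolding eventually_at_top_linorder by blast
  obtain x where x: "x \<in> B (e + 2)" "max m N \<le> x"
    using assms unfolding infinite_nat_iff_unbounded_le by blast
  \<comment> \<open>The code of the pair is at least \<open>x\<close>, hence at least
    \<open>N\<close>, so the pair cannot be present at stage \<open>N\<close>.\<close>
  have "\<not> mem (e + 2) (state N) x"
    using mem_less[of "e + 2" N x] le_prod_encode_2[of x "e + 2"] x(2) by auto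
  from mem_new[OF x(1) this] obtain t where t: "N \<le> t" "\<forall>n\<le>x. agrees t (state t) e n"
    unfolding mem_Suc_agrees by blast
  then show ?thesis using N[OF t(1)] x(2) by auto
qed

lemma holds_marked:
  assumes "\<And>m. holds e m" shows "x \<in> B (e + 2)"
proof -
  have "\<forall>\<^sub>F s in at_top. \<forall>n\<in>{..x}. agrees s (state s) e n"
    using eventually_agrees[of e] assms by (intro eventually_ball_finite) auto
  then have "\<forall>\<^sub>F s in at_top. mem (e + 2) (state (Suc s)) x"
    using eventually_ge_at_top[of "prod_encode (e + 2, x)"]
    by eventually_elim (auto simp only: mem_Suc_agrees atMost_iff)
  then show ?thesis unfolding B_def eventually_at_top_linorder by blast
qed

text \<open>Once all numbers protected by stronger requirements have stopped entering \<open>A\<close>, a number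
  protected by \<open>e\<close> can only enter the side that \<open>e\<close> does not protect. So membership in the
  protected side can be read off at the first stage at which the number is protected.\<close>
lemma decidable_protected:
  assumes "infinite (B (e + 2))" "\<And>d. d < e \<Longrightarrow> finite (B (d + 2))"
  shows "decidable (\<lambda>x. x \<in> B (e mod 2))"
proof -
  define i where "i = e mod 2"
  have i: "i < 2" by (simp add: i_def)
  \<comment> \<open>The elements of \<open>A\<close> that stronger requirements ever protect:
    finitely many, so after some stage \<open>s0\<close> all of them have been placed.\<close>
  define F where "F = (\<Union>d<e. B (d + 2)) \<inter> A"
  have "finite F" using assms(2) by (auto simp: F_def)
  have "\<forall>\<^sub>F s in at_top. \<forall>x\<in>F. mem 0 (state s) x \<or> mem 1 (state s) x"
  proof (rule eventually_ball_finite[OF \<open>finite F\<close>], rule ballI)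
    fix x assume "x \<in> F"
    then have "x \<in> B 0 \<or> x \<in> B 1" using A_eq by (auto simp: F_def)
    with eventually_mem[of 0 x] eventually_mem[of 1 x]
    show "\<forall>\<^sub>F s in at_top. mem 0 (state s) x \<or> mem 1 (state s) x"
      by (auto elim: eventually_mono)
  qed
  then obtain s0 where s0: "\<And>x. x \<in> F \<Longrightarrow> mem 0 (state s0) x \<or> mem 1 (state s0) x"
    unfolding eventually_at_top_linorder by blast
  have settled: "x \<in> B i \<longleftrightarrow> mem i (state s) x" if s: "s0 \<le> s" "mem (e + 2) (state s) x" for s x
  proof
    assume "x \<in> B i"
    show "mem i (state s) x"
    proof (rule ccontr)
      assume "\<not> mem i (state s) x"
      from mem_new[OF \<open>x \<in> B i\<close> this] obtain t where t: "s \<le> t" "enters t (state t) i x"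
        using mem_Suc_enters[OF i] by blast
      then have x: "E t x" "\<not> mem 0 (state t) x" "\<not> mem 1 (state t) x"
        and div: "if diverted t (state t) x then i = 1 else i = 0" by (auto simp: enters_def)
      have "s0 \<le> t" using s(1) t(1) by simp
      then have "x \<notin> F" using s0[of x] mem_mono[of 0 s0 x t] mem_mono[of 1 s0 x t] x by blast
      moreover have "x \<in> A" using x(1) E_iff by blast
      ultimately have low: "\<not> mem (d + 2) (state t) x" if "d < e" for d
        using that by (auto simp: F_def B_def)
      have me: "mem (e + 2) (state t) x" by (rule mem_mono[OF s(2) t(1)])
      then have et: "e < t" using mem_less[OF me] le_prod_encode_1[of "e + 2" x] by linarith
      \<comment> \<open>If \<open>e\<close> guards side 0, it is itself the strongest requirement
        protecting \<open>x\<close> and diverts it.\<close>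
      have i0: "diverted t (state t) x" if "i = 0"
      proof -
        have "e mod 2 = 0" using that by (simp only: i_def)
        then show ?thesis unfolding diverted_def by (intro exI[of _ e] conjI allI impI low et me)
      qed
      have dv: "diverted t (state t) x"
      proof (rule ccontr)
        assume "\<not> diverted t (state t) x"
        moreover from this div have "i = 0" by (simp only: if_False)
        ultimately show False using i0 by blast
      qed
      then have "i = 1" using div by simp
      from dv obtain d where "d < t \<and> d mod 2 = 0 \<and> mem (d + 2) (state t) x \<and> (\<forall>c<d. \<not> mem (c + 2) (state t) x)"
        unfolding diverted_def ..
      then have d: "d mod 2 = 0" "mem (d + 2) (state t) x" "\<forall>c<d. \<not> mem (c + 2) (state t) x" by iprover+
      \<comment> \<open>Both \<open>d\<close> and \<open>e\<close> are the strongest requirement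
        protecting \<open>x\<close>, so they coincide; but \<open>d\<close> is even and
        \<open>e\<close> is odd.\<close>
      have "\<not> d < e" using low d(2) by blast
      moreover have "\<not> e < d" using d(3) me by blast
      ultimately have "d = e" by simp
      with d(1) \<open>i = 1\<close> show False by (simp add: i_def)
    qed
  qed (auto simp: B_def)
  define g where "g x = (LEAST s. s0 \<le> s \<and> mem (e + 2) (state s) x)" for x
  \<comment> \<open>Infinitely many protected numbers make the inequality true everywhere, so every
    number is eventually protected and the search \<open>g\<close> is total.\<close>
  have ex: "\<exists>s. s0 \<le> s \<and> mem (e + 2) (state s) x" for x
  proof -
    have "x \<in> B (e + 2)" using holds_marked infinite_marks_holds[OF assms(1)] by blast
    then obtain s where "mem (e + 2) (state s) x" by (auto simp: B_def)
    then have "mem (e + 2) (state (max s0 s)) x" by (rule mem_mono) simp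
    then show ?thesis by (intro exI[of _ "max s0 s"]) simp
  qed
  have "x \<in> B i \<longleftrightarrow> mem i (state (g x)) x" for x
    using settled LeastI_ex[OF ex[of x]] unfolding g_def by blast
  moreover have "computable g"
    unfolding g_def by (rule computable_LEAST[OF _ ex]) (intro computable_intros computable_state)
  then have "decidable (\<lambda>x. mem i (state (g x)) x)"
    by (intro computable_intros computable_state)
  ultimately show ?thesis by (simp add: i_def)
qed

text \<open>Induction on priority supplies the finiteness for stronger requirements that
  \<open>decidable_protected\<close> assumes.\<close>

lemma finite_marks: "finite (B (e + 2))"
proof (induction e rule: less_induct)
  case (less e)
  show ?case
  proof (rule ccontr)
    assume inf: "infinite (B (e + 2))"
    have dec: "decidable (\<lambda>x. x \<in> B (e mod 2))" using decidable_protected[OF inf] less by blast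
    have "K_le U (Y e) (B (e mod 2))"
      using infinite_marks_holds[OF inf] unfolding K_le_def holds_def by blast
    then have trivial: "K_le U (Y e) {}" using K_le_decidable[OF U dec] K_le_trans by blast
    show False
    proof (cases "e mod 4 < 2")
      case True
      with trivial X_nontrivial show False by (simp add: Y_def)
    next
      case False
      \<comment> \<open>Here \<open>Y e\<close> is the other half, so \<open>A\<close> arises from
        it by adding a decidable set.\<close>
      have "A = B (1 - e mod 2) \<union> B (e mod 2)"
        using A_eq by (cases "e mod 2 = 0") (auto simp: mod2_eq_if)
      then have "K_le U A (Y e)" using K_le_Un_decidable[OF U dec] False by (simp add: Y_def)
      with trivial A_nontrivial K_le_trans show False by blast
    qed
  qed
qed

section \<open>The required relations between the halves, \<open>A\<close> and
  \<open>X\<close>\<close>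

lemma not_K_le_Y:
  fixes i j :: nat
  assumes "i < 2" "j < 2" shows "\<not> K_le U (if j = 0 then X else B (1 - i)) (B i)"
proof
  assume "K_le U (if j = 0 then X else B (1 - i)) (B i)"
  then obtain c where c: "\<And>n. KM U (init_seg (if j = 0 then X else B (1 - i)) n) \<le> KM U (init_seg (B i) n) + enat c"
    unfolding K_le_def by blast
  \<comment> \<open>The index packs the constant \<open>c\<close>, the choice \<open>j\<close> of
    the comparison set and the side \<open>i\<close>; if its inequality held throughout, it would
    protect every number.\<close>
  define e where "e = 4 * c + 2 * j + i"
  have e: "e mod 2 = i" "e div 4 = c" "e mod 4 < 2 \<longleftrightarrow> j = 0"
    using assms unfolding e_def by presburger+
  have "holds e m" for m using c[of m] unfolding holds_def Y_def e .
  then have "B (e + 2) = UNIV" using holds_marked by blast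
  with finite_marks[of e] show False by simp
qed

text \<open>From a segment of \<open>A\<close>, search for a stage at which all its elements have
  been placed. Placement is final, so that stage already shows the segment of
  \<open>B i\<close>.\<close>

lemma K_le_A:
  assumes "i < 2" shows "K_le U (B i) A"
proof -
  let ?in = "\<lambda>s x. mem 0 (state s) x \<or> mem 1 (state s) x"
  let ?P = "\<lambda>v s. seg_code (?in s) (strlen v) = v"
  let ?F = "\<lambda>v s. seg_code (mem i (state s)) (strlen v)"
  show ?thesis
  proof (rule K_le_search[OF U, where P = ?P and F = ?F])
    show "decidable (\<lambda>z. ?P (pfst z) (psnd z))" "computable (\<lambda>z. ?F (pfst z) (psnd z))"
      by (intro computable_intros computable_state)+
    fix n
    have "\<forall>\<^sub>F s in at_top. ?in s x \<longleftrightarrow> x \<in> A" for x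
      using eventually_mem[of 0 x] eventually_mem[of 1 x] by eventually_elim (simp add: A_eq)
    from eventually_seg_code[OF this, of n] show "\<exists>s. ?P (enc (init_seg A n)) s"
      unfolding eventually_at_top_linorder by auto
    fix s assume "?P (enc (init_seg A n)) s"
    then have "seg_code (?in s) n = seg_code (\<lambda>x. x \<in> A) n" by (simp add: enc_init_seg[symmetric])
    from seg_code_eqD[OF this] have in_iff: "?in s x \<longleftrightarrow> x \<in> A" if "x < n" for x using that by blast
    have "mem i (state s) x \<longleftrightarrow> x \<in> B i" if "x < n" for x
    proof
      assume x: "x \<in> B i"
      then have "x \<in> A" using assms A_eq by (auto simp: less_2_cases_iff)
      with in_iff that have "?in s x" by blast
      moreover have "x \<in> B j" if "mem j (state s) x" for j using that by (auto simp: B_def)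
      ultimately show "mem i (state s) x" using x B_disjoint assms by (auto simp: less_2_cases_iff)
    qed (auto simp: B_def)
    from seg_code_cong[OF this] show "?F (enc (init_seg A n)) s = enc (init_seg (B i) n)"
      unfolding strlen_enc length_init_seg enc_init_seg[of "B i"] .
  qed
qed

end

theorem theorem6p2:
  fixes U :: "bool list \<Rightarrow> bool list option" and A X :: "nat set"
  assumes "optimal_pf_machine U"
    and "ce A" and "\<not> K_le U A {}"
    and "delta02 X" and "\<not> K_le U X {}"
  shows "\<exists>A0 A1. ce A0 \<and> ce A1 \<and> A0 \<inter> A1 = {} \<and> A = A0 \<union> A1 \<and>
           \<not> K_le U A0 A1 \<and> \<not> K_le U A1 A0 \<and>
           (\<forall>Ai \<in> {A0, A1}. K_le U Ai A \<and> \<not> K_le U A Ai \<and> \<not> K_le U X Ai)"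
proof -
  obtain q where q: "\<And>\<tau> \<sigma>. eval q [enc \<tau>] (enc \<sigma>) \<longleftrightarrow> U \<tau> = Some \<sigma>"
    using assms(1) by (auto simp: optimal_pf_machine_def prefix_free_machine_def partial_computable_machine_def)
  obtain H where H: "approximates H (eval q)" using eval_approximable by blast
  obtain E where E: "decidable (\<lambda>z. E (pfst z) (psnd z))" "\<And>x. x \<in> A \<longleftrightarrow> (\<exists>s. E s x)"
    "\<And>s t x. E s x \<Longrightarrow> s \<le> t \<Longrightarrow> E t x"
    using ce_stages[OF assms(2)] by blast
  obtain L where L: "decidable (\<lambda>z. L (pfst z) (psnd z))" "\<And>x. \<forall>\<^sub>F s in at_top. L s x \<longleftrightarrow> x \<in> X"
    using delta02_limit[OF assms(4)] by blast
  interpret splitting U A X E L q H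
    by unfold_locales (fact assms q H E L)+
  have incomparable: "\<not> K_le U (B 0) (B 1)" "\<not> K_le U (B 1) (B 0)"
    using not_K_le_Y[of 1 1] not_K_le_Y[of 0 1] by simp_all
  have X: "\<not> K_le U X (B 0)" "\<not> K_le U X (B 1)"
    using not_K_le_Y[of 0 0] not_K_le_Y[of 1 0] by simp_all
  have le: "K_le U (B 0) A" "K_le U (B 1) A" by (simp_all add: K_le_A)
  have "\<not> K_le U A (B 0)" "\<not> K_le U A (B 1)"
    using incomparable le K_le_trans by blast+
  then show ?thesis
    using incomparable X le ce_B B_disjoint A_eq by (intro exI[of _ "B 0"] exI[of _ "B 1"]) simp
qed

end
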